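(* Let $D\subset\mathbb{R}^m$ and $E\subset\mathbb{R}^r$ be compact sets with Lipschitz boundaries. Fix $\delta>0$ and let $K\subseteq\mathcal{X}_\delta$ be any compact set (with respect to the supremum norm). For any $\varepsilon>0$ there exists a neural operator $\Psi$ with input and output spaces $\mathcal{F}_{\mathrm{in}}=\mathcal{F}_{\mathrm{out}}=C(D\times E)$ such that $$\sup_{\rho\in K}\|\mathcal{G}^\star(\rho)-\Psi(\rho)\|_{C(D\times E)}\le\varepsilon .$$
   Context: **Densities and conditioning.** $C(D\times E)$ is the space of continuous real-valued functions with the supremum norm. $C_{\mathrm{ac}}(D\times E)$ is the set of $\rho\in C(D\times E)$ with $\rho\ge 0$ and $\int_{D\times E}\rho(z)\,dz=1$. For such $\rho$, $m_\rho(y)=\int_D\rho(x,y)\,dx$ for $y\in E$. For $\delta>0$, $\mathcal{X}_\delta=\{\rho\in C_{\mathrm{ac}}(D\times E): \inf_{y\in E}m_\rho(y)\ge\delta\}$, equipped with the supremum-norm metric. The kernel conditioning operator is $\mathcal{G}^\star:\mathcal{X}_\delta\to C(D\times E)$, $\mathcal{G}^\star(\rho)(x,y)=\rho(x,y)/m_\rho(y)$. **Neural operators.** A neural network is a standard feedforward neural network between finite-dimensional spaces. Let $\Omega\subset\mathbb{R}^{d'}$ be a Lipschitz domain (here $\Omega=D\times E$, $d'=m+r$), and let $\mathcal{F}_{\mathrm{in}},\mathcal{F}_{\mathrm{out}}$ be collections of functions $\Omega\to\mathbb{R}^{d_{\mathrm{in}}}$ and $\Omega\to\mathbb{R}^{d_{\mathrm{out}}}$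 (here $d_{\mathrm{in}}=d_{\mathrm{out}}=1$). A neural operator of depth $L>0$ is a map $\Psi=\mathcal{Q}\circ\mathcal{L}_L\circ\cdots\circ\mathcal{L}_1\circ\mathcal{R}:\mathcal{F}_{\mathrm{in}}\to\mathcal{F}_{\mathrm{out}}$ where, for some $d_0,\dots,d_L\in\mathbb{N}$ and collections $\mathcal{F}_\ell$ of functions $\Omega\to\mathbb{R}^{d_\ell}$: - (lifting layer) $\mathcal{R}:\mathcal{F}_{\mathrm{in}}\to\mathcal{F}_0$, $\mathcal{R}(f)(x)=R(x,f(x))$ with $R:\mathbb{R}^{d'+d_{\mathrm{in}}}\to\mathbb{R}^{d_0}$ a neural network; - (hidden layers) $\mathcal{L}_\ell:\mathcal{F}_{\ell-1}\to\mathcal{F}_\ell$, $\mathcal{L}_\ell(f)(x)=\sigma\bigl(W_\ell f(x)+b_\ell+\sum_{j=1}^{M_\ell}\langle T_{\ell,j}f,\psi_{\ell,j}\rangle\,\phi_{\ell,j}(x)\bigr)$, where $\sigma:\mathbb{R}\to\mathbb{R}$ is a nonlinearity (activation function) applied componentwise, $W_\ell\in\mathbb{R}^{d_\ell\times d_{\ell-1}}$, $b_\ell\in\mathbb{R}^{d_\ell}$, $T_{\ell,j}:\mathbb{R}^{d_{\ell-1}}\to\mathbb{R}^{d_\ell}$ is linear and applied pointwise, $\psi_{\ell,j}:\Omega\to\mathbb{R}^{d_\ell}$ (encoding functions) and $\phi_{\ell,j}\in\mathcal{F}_\ell$ (decoding functions) are fixed functions, and $\langle u,v\rangle=\int_\Omega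 u(x)\cdot v(x)\,dx$; - (projection layer) $\mathcal{Q}:\mathcal{F}_L\to\mathcal{F}_{\mathrm{out}}$, $\mathcal{Q}(f)(x)=Q(x,f(x))$ with $Q:\mathbb{R}^{d'+d_L}\to\mathbb{R}^{d_{\mathrm{out}}}$ a neural network. All ingredients are such that these layers are well-defined maps between the indicated spaces. *)

theory Defs
  imports "HOL-Analysis.Analysis" "Jordan_Normal_Form.Matrix"
begin

section \<open>Sets with Lipschitz boundary\<close>

text \<open>Near each boundary point, the set is the epigraph of a Lipschitz function over the
  hyperplane orthogonal to a unit vector \<open>v\<close> (\<open>v\<close> is the last coordinate axis after a rotation).\<close>

definition lipschitz_boundary :: "'a::euclidean_space set \<Rightarrow> bool" where
  "lipschitz_boundary S \<longleftrightarrow>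
     (\<forall>p \<in> frontier S. \<exists>U v \<gamma> C.
        open U \<and> p \<in> U \<and> norm v = 1 \<and> C-lipschitz_on {w. inner w v = 0} \<gamma> \<and>
        S \<inter> U = {x \<in> U. \<gamma> (x - inner x v *\<^sub>R v) \<le> inner x v})"


section \<open>Continuous densities and kernel conditioning\<close>

text \<open>Functions on \<open>\<Omega>\<close> are total functions that are extensional on \<open>\<Omega>\<close>; the metric of
  \<^const>\<open>cfunspace\<close> is the supremum metric. For compact \<open>\<Omega>\<close> the boundedness
  requirement in \<^const>\<open>cfunspace\<close> is automatic.\<close>

abbreviation cont_space :: "'a::topological_space set \<Rightarrow> ('a \<Rightarrow> real) metric" where
  "cont_space \<Omega> \<equiv> cfunspace (top_of_set \<Omega>) euclidean_metric"

definition ac_densities :: "'a::euclidean_space set \<Rightarrow> ('a \<Rightarrow> real) set" where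
  "ac_densities \<Omega> =
     {\<rho> \<in> mspace (cont_space \<Omega>). (\<forall>z \<in> \<Omega>. 0 \<le> \<rho> z) \<and> (LINT z:\<Omega>|lborel. \<rho> z) = 1}"

definition marginal :: "'a::euclidean_space set \<Rightarrow> ('a \<times> 'b \<Rightarrow> real) \<Rightarrow> 'b \<Rightarrow> real" where
  "marginal D \<rho> y = (LINT x:D|lborel. \<rho> (x, y))"

text \<open>The infimum is a genuine one: densities are nonnegative, and there are none if \<open>E\<close> is empty.\<close>

definition X_space ::
    "'a::euclidean_space set \<Rightarrow> 'b::euclidean_space set \<Rightarrow> real \<Rightarrow> ('a \<times> 'b \<Rightarrow> real) set" where
  "X_space D E \<delta> = {\<rho> \<in> ac_densities (D \<times> E). \<delta> \<le> (INF y\<in>E. marginal D \<rho> y)}"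

definition kernel_cond ::
    "'a::euclidean_space set \<Rightarrow> 'b::euclidean_space set \<Rightarrow> ('a \<times> 'b \<Rightarrow> real) \<Rightarrow> 'a \<times> 'b \<Rightarrow> real" where
  "kernel_cond D E \<rho> = (\<lambda>(x, y) \<in> D \<times> E. \<rho> (x, y) / marginal D \<rho> y)"


section \<open>Feedforward neural networks\<close>

text \<open>\<open>neural_network \<sigma> p q N\<close>: the map \<open>N\<close> from \<open>\<real>\<^sup>p\<close> to \<open>\<real>\<^sup>q\<close> is a feedforward network
  of arbitrary finite depth and widths, whose output layer has no activation.\<close>

inductive neural_network ::
    "(real \<Rightarrow> real) \<Rightarrow> nat \<Rightarrow> nat \<Rightarrow> (real Matrix.vec \<Rightarrow> real Matrix.vec) \<Rightarrow> bool"
  for \<sigma> :: "real \<Rightarrow> real" where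
  affine: "A \<in> carrier_mat q p \<Longrightarrow> b \<in> carrier_vec q
     \<Longrightarrow> neural_network \<sigma> p q (\<lambda>v. A *\<^sub>v v + b)"
| layer: "neural_network \<sigma> p n N \<Longrightarrow> A \<in> carrier_mat q n \<Longrightarrow> b \<in> carrier_vec q
     \<Longrightarrow> neural_network \<sigma> p q (\<lambda>v. A *\<^sub>v map_vec \<sigma> (N v) + b)"


section \<open>Neural operators\<close>

text \<open>Coordinates with respect to the standard basis, in some fixed order; since network
  weights are arbitrary, the order is immaterial.\<close>

definition coords :: "'a::euclidean_space \<Rightarrow> real Matrix.vec" where
  "coords x = Matrix.vec DIM('a) (\<lambda>i. inner x (from_nat_into Basis i))"

definition lifting_layer ::
    "'a::euclidean_space set \<Rightarrow> (real Matrix.vec \<Rightarrow> real Matrix.vec)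
     \<Rightarrow> ('a \<Rightarrow> real) \<Rightarrow> 'a \<Rightarrow> real Matrix.vec" where
  "lifting_layer \<Omega> R f = (\<lambda>x\<in>\<Omega>. R (coords x @\<^sub>v Matrix.vec 1 (\<lambda>_. f x)))"

definition projection_layer ::
    "'a::euclidean_space set \<Rightarrow> (real Matrix.vec \<Rightarrow> real Matrix.vec)
     \<Rightarrow> ('a \<Rightarrow> real Matrix.vec) \<Rightarrow> 'a \<Rightarrow> real" where
  "projection_layer \<Omega> Q f = (\<lambda>x\<in>\<Omega>. vec_index (Q (coords x @\<^sub>v f x)) 0)"

definition pairing ::
    "'a::euclidean_space set \<Rightarrow> ('a \<Rightarrow> real Matrix.vec) \<Rightarrow> ('a \<Rightarrow> real Matrix.vec) \<Rightarrow> real" where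
  "pairing \<Omega> u v = (LINT x:\<Omega>|lborel. scalar_prod (u x) (v x))"

definition hidden_layer ::
    "(real \<Rightarrow> real) \<Rightarrow> 'a::euclidean_space set \<Rightarrow> nat \<Rightarrow> real mat \<Rightarrow> real Matrix.vec \<Rightarrow> nat
     \<Rightarrow> (nat \<Rightarrow> real mat) \<Rightarrow> (nat \<Rightarrow> 'a \<Rightarrow> real Matrix.vec) \<Rightarrow> (nat \<Rightarrow> 'a \<Rightarrow> real Matrix.vec)
     \<Rightarrow> ('a \<Rightarrow> real Matrix.vec) \<Rightarrow> 'a \<Rightarrow> real Matrix.vec" where
  "hidden_layer \<sigma> \<Omega> n W b M T \<psi> \<phi> f =
     (\<lambda>x\<in>\<Omega>. map_vec \<sigma>
        (W *\<^sub>v f x + b +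
         Matrix.vec n (\<lambda>i. \<Sum>j<M. pairing \<Omega> (\<lambda>z. T j *\<^sub>v f z) (\<psi> j) * vec_index (\<phi> j x) i)))"

text \<open>\<open>neural_operator \<sigma> \<Omega> Fin Fout \<Psi>\<close>: on \<open>Fin\<close>, the map \<open>\<Psi>\<close> is a neural operator with
  activation \<open>\<sigma>\<close> and real-valued inputs and outputs. Well-definedness of the layers is part of
  the definition: the inner products must exist as Lebesgue integrals, and each layer must map
  its function space into the next one.\<close>

definition neural_operator ::
    "(real \<Rightarrow> real) \<Rightarrow> 'a::euclidean_space set \<Rightarrow> ('a \<Rightarrow> real) set \<Rightarrow> ('a \<Rightarrow> real) set
     \<Rightarrow> (('a \<Rightarrow> real) \<Rightarrow> ('a \<Rightarrow> real)) \<Rightarrow> bool" where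
  "neural_operator \<sigma> \<Omega> Fin Fout \<Psi> \<longleftrightarrow>
     (\<exists>(L::nat) (d :: nat \<Rightarrow> nat) (F :: nat \<Rightarrow> ('a \<Rightarrow> real Matrix.vec) set) R W b M T \<psi> \<phi> Q.
        0 < L \<and>
        (\<forall>l \<le> L. 0 < d l \<and> F l \<subseteq> \<Omega> \<rightarrow>\<^sub>E carrier_vec (d l)) \<and>
        neural_network \<sigma> (DIM('a) + 1) (d 0) R \<and>
        lifting_layer \<Omega> R \<in> Fin \<rightarrow> F 0 \<and>
        (\<forall>l \<in> {1..L}.
           W l \<in> carrier_mat (d l) (d (l - 1)) \<and>
           b l \<in> carrier_vec (d l) \<and>
           (\<forall>j < M l.
              T l j \<in> carrier_mat (d l) (d (l - 1)) \<and>
              \<psi> l j \<in> \<Omega> \<rightarrow> carrier_vec (d l) \<and>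
              \<phi> l j \<in> F l \<and>
              (\<forall>f \<in> F (l - 1).
                 set_integrable lborel \<Omega> (\<lambda>z. scalar_prod (T l j *\<^sub>v f z) (\<psi> l j z)))) \<and>
           hidden_layer \<sigma> \<Omega> (d l) (W l) (b l) (M l) (T l) (\<psi> l) (\<phi> l) \<in> F (l - 1) \<rightarrow> F l) \<and>
        neural_network \<sigma> (DIM('a) + d L) 1 Q \<and>
        projection_layer \<Omega> Q \<in> F L \<rightarrow> Fout \<and>
        (\<forall>f \<in> Fin.
           \<Psi> f = projection_layer \<Omega> Q
                   (fold (\<lambda>l. hidden_layer \<sigma> \<Omega> (d l) (W l) (b l) (M l) (T l) (\<psi> l) (\<phi> l))
                      [1..<Suc L] (lifting_layer \<Omega> R f))))"

end

theory Submission
  imports Defs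
begin

text \<open>One hidden layer suffices. Its nonlocal term produces a finite-rank approximation
  \<open>v(y) = \<Sum>\<^sub>j c\<^sub>j \<theta>\<^sub>j(y)\<close> of the marginal, where \<open>c\<^sub>j\<close> is the average of the marginal over
  a small piece of \<open>E\<close> and the \<open>\<theta>\<^sub>j\<close> are a partition of unity; the error is uniform on \<open>K\<close>
  because \<open>K\<close> is equicontinuous, and the pieces have positive measure because \<open>E\<close> has
  Lipschitz boundary. The pointwise map \<open>(u, v) \<mapsto> u / v\<close> is then approximated by a feedforward
  network, whose first layer is the hidden layer and whose remaining layers form the projection.

  Density of networks for a continuous non-affine activation: averaging the activation twice over
  a window gives a \<open>C\<^sup>2\<close> limit of shallow networks with a nonzero second derivative somewhere, so
  second difference quotients yield \<open>t\<^sup>2\<close>. Hence deep networks approximate products, and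
  Stone--Weierstrass applies.\<close>

section \<open>Density of feedforward networks\<close>

text \<open>A hidden layer sees its input only through finitely many integrals, so the value of the
  marginal at a single \<open>y\<close> is out of its reach; this is why local averages take its
  place. Encoding functions need only be integrable against the fields of the preceding space and
  may be normalised indicators, whereas decoding functions must lie in a space of continuous fields,
  hence the tents. Division is harmless: the marginals are at least \<delta>, an error of at most
  \<delta>/2 keeps the approximants at least \<delta>/2, and \<open>K\<close> is bounded, so the
  quotient matters only on a compact rectangle on which it is continuous.

  An affine \<sigma> would make every operator affine in the density, so non-affinity has to enter
  somewhere. A polynomial \<sigma> is allowed, and networks of a fixed depth then yield polynomials
  of bounded degree; the depth must therefore depend on the accuracy, and density has to be proved
  for networks of arbitrary depth.\<close>

text \<open>A coordinate-free model of scalar networks with \<open>k\<close> activation layers on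
  any normed space. A finite set of neurons in place of a weight matrix makes linear combinations a
  matter of taking unions; matrices enter only when the networks are realised.\<close>

primrec nets :: "(real \<Rightarrow> real) \<Rightarrow> nat \<Rightarrow> ('a::real_normed_vector \<Rightarrow> real) set" where
  "nets \<sigma> 0 = {f. \<exists>l c. bounded_linear l \<and> f = (\<lambda>x. l x + c)}"
| "nets \<sigma> (Suc k) =
    {f. \<exists>c G a. finite G \<and> G \<subseteq> nets \<sigma> k \<and> f = (\<lambda>x. c + (\<Sum>g\<in>G. a g * \<sigma> (g x)))}"

lemma nets_0I: "bounded_linear l \<Longrightarrow> (\<lambda>x. l x + c) \<in> nets \<sigma> 0"
  by auto

lemma nets_0E:
  assumes "f \<in> nets \<sigma> 0"
  obtains l c where "bounded_linear l" "f = (\<lambda>x. l x + c)"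
  using assms by auto

lemma nets_SucI:
  "finite G \<Longrightarrow> G \<subseteq> nets \<sigma> k \<Longrightarrow> (\<lambda>x. c + (\<Sum>g\<in>G. a g * \<sigma> (g x))) \<in> nets \<sigma> (Suc k)"
  by auto

lemma nets_SucE:
  assumes "f \<in> nets \<sigma> (Suc k)"
  obtains c G a where "finite G" "G \<subseteq> nets \<sigma> k" "f = (\<lambda>x. c + (\<Sum>g\<in>G. a g * \<sigma> (g x)))"
  using assms by auto

declare nets.simps [simp del]

lemma nets_const: "(\<lambda>_. c) \<in> nets \<sigma> k"
proof (cases k)
  case 0
  have "bounded_linear (\<lambda>_::'a. 0::real)" by (rule bounded_linear_zero)
  from nets_0I[OF this, of c] 0 show ?thesis by simp
next
  case (Suc k)
  show ?thesis using nets_SucI[of "{}" \<sigma> _ c] Suc by simp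
qed

lemma nets_lincomb:
  assumes "f \<in> nets \<sigma> k" "g \<in> nets \<sigma> k"
  shows "(\<lambda>x. a * f x + b * g x) \<in> nets \<sigma> k"
proof (cases k)
  case 0
  from assms 0 obtain l c l' c' where *: "bounded_linear l" "f = (\<lambda>x. l x + c)"
    "bounded_linear l'" "g = (\<lambda>x. l' x + c')"
    by (metis nets_0E)
  have "bounded_linear (\<lambda>x. a * l x + b * l' x)"
    using * by (intro bounded_linear_add bounded_linear_const_mult)
  moreover have "(\<lambda>x. a * f x + b * g x) = (\<lambda>x. (a * l x + b * l' x) + (a * c + b * c'))"
    by (auto simp: * algebra_simps)
  ultimately show ?thesis
    using nets_0I[of "\<lambda>x. a * l x + b * l' x" "a * c + b * c'"] 0 by simp
next
  case (Suc m)
  obtain c G u where f: "finite G" "G \<subseteq> nets \<sigma> m" "f = (\<lambda>x. c + (\<Sum>h\<in>G. u h * \<sigma> (h x)))"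
    using assms(1) unfolding Suc by (rule nets_SucE)
  obtain c' G' u' where g: "finite G'" "G' \<subseteq> nets \<sigma> m" "g = (\<lambda>x. c' + (\<Sum>h\<in>G'. u' h * \<sigma> (h x)))"
    using assms(2) unfolding Suc by (rule nets_SucE)
  note * = f g
  \<comment> \<open>Coefficients are padded by zero outside each neuron set, so that both sums run
    over \<open>G \<union> G'\<close>; a neuron common to both collects both contributions.\<close>
  define w where "w h = a * (if h \<in> G then u h else 0) + b * (if h \<in> G' then u' h else 0)" for h
  have "a * f x + b * g x = (a * c + b * c') + (\<Sum>h\<in>G \<union> G'. w h * \<sigma> (h x))" for x
  proof -
    have "(\<Sum>h\<in>G. u h * \<sigma> (h x)) = (\<Sum>h\<in>G \<union> G'. (if h \<in> G then u h else 0) * \<sigma> (h x))"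
      using * by (intro sum.mono_neutral_cong_left) auto
    moreover
    have "(\<Sum>h\<in>G'. u' h * \<sigma> (h x)) = (\<Sum>h\<in>G \<union> G'. (if h \<in> G' then u' h else 0) * \<sigma> (h x))"
      using * by (intro sum.mono_neutral_cong_left) auto
    ultimately show ?thesis
      unfolding w_def *(3,6) by (simp add: distrib_left distrib_right sum.distrib sum_distrib_left mult.assoc)
  qed
  then have "(\<lambda>x. a * f x + b * g x) = (\<lambda>x. (a * c + b * c') + (\<Sum>h\<in>G \<union> G'. w h * \<sigma> (h x)))"
    by blast
  also have "\<dots> \<in> nets \<sigma> (Suc m)" using * by (intro nets_SucI) auto
  finally show ?thesis using Suc by simp
qed

lemma nets_sum:
  assumes "finite I" "\<And>i. i \<in> I \<Longrightarrow> f i \<in> nets \<sigma> k"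
  shows "(\<lambda>x. \<Sum>i\<in>I. a i * f i x) \<in> nets \<sigma> k"
  using assms
proof (induction I rule: finite_induct)
  case empty
  then show ?case by (simp add: nets_const)
next
  case (insert i I)
  have "(\<lambda>x. a i * f i x + 1 * (\<Sum>i\<in>I. a i * f i x)) \<in> nets \<sigma> k"
    using insert by (intro nets_lincomb) auto
  then show ?case using insert by simp
qed

lemma nets_act:
  assumes "f \<in> nets \<sigma> k"
  shows "(\<lambda>x. \<sigma> (f x)) \<in> nets \<sigma> (Suc k)"
  using nets_SucI[of "{f}" \<sigma> k 0 "\<lambda>_. 1"] assms by simp

lemma nets_affine_comp:
  assumes "f \<in> nets \<sigma> k"
  shows "(\<lambda>x. a * f x + b) \<in> nets \<sigma> k"
  using nets_lincomb[OF assms nets_const[of 1], of a b] by simp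

text \<open>The neurons of \<open>s\<close> are affine functions of one real variable, and an affine
  function of the output of \<open>f\<close> merges into its affine output layer. Hence only the
  single activation of \<open>s\<close> adds to the depth.\<close>

lemma nets_comp:
  fixes s :: "real \<Rightarrow> real"
  assumes "s \<in> nets \<sigma> 1" "f \<in> nets \<sigma> k"
  shows "(\<lambda>x. s (f x)) \<in> nets \<sigma> (Suc k)"
proof -
  from assms(1) obtain c G a where s: "finite G" "G \<subseteq> nets \<sigma> 0"
    "s = (\<lambda>x. c + (\<Sum>g\<in>G. a g * \<sigma> (g x)))" unfolding One_nat_def by (rule nets_SucE)
  have "(\<lambda>x. \<sigma> (g (f x))) \<in> nets \<sigma> (Suc k)" if g: "g \<in> G" for g
  proof -
    from g s have "g \<in> nets \<sigma> 0" by auto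
    then obtain l d where l: "bounded_linear l" "g = (\<lambda>x. l x + d)" by (rule nets_0E)
    have "l t = l 1 * t" for t
      using linear_cmul[OF bounded_linear.linear[OF l(1)], of t 1] by simp
    then have "g = (\<lambda>x. l 1 * x + d)" using l(2) by metis
    then have "(\<lambda>x. g (f x)) \<in> nets \<sigma> k"
      using nets_affine_comp[OF assms(2)] by simp
    then show ?thesis by (rule nets_act)
  qed
  then have "(\<lambda>x. \<Sum>g\<in>G. a g * \<sigma> (g (f x))) \<in> nets \<sigma> (Suc k)"
    using s(1) by (intro nets_sum) auto
  from nets_affine_comp[OF this, of 1 c] show ?thesis
    by (simp add: s(3) add.commute)
qed

section \<open>Uniform limits of networks\<close>

definition unif_closure :: "'a set \<Rightarrow> ('a \<Rightarrow> real) set \<Rightarrow> ('a \<Rightarrow> real) set" where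
  "unif_closure S F = {f. \<forall>e>0. \<exists>g\<in>F. \<forall>x\<in>S. \<bar>f x - g x\<bar> < e}"

lemma unif_closure_superset: "f \<in> F \<Longrightarrow> f \<in> unif_closure S F"
  unfolding unif_closure_def by (auto intro!: bexI[of _ f])

lemma unif_closureE:
  assumes "f \<in> unif_closure S F" "e > 0"
  obtains g where "g \<in> F" "\<And>x. x \<in> S \<Longrightarrow> \<bar>f x - g x\<bar> < e"
  using assms unfolding unif_closure_def by blast

text \<open>The closure is idempotent: approximants may themselves be limits, so approximation steps
  can be chained without carrying errors along.\<close>

lemma unif_closureI:
  assumes "\<And>e. e > 0 \<Longrightarrow> \<exists>g\<in>unif_closure S F. \<forall>x\<in>S. \<bar>f x - g x\<bar> < e"
  shows "f \<in> unif_closure S F"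
  unfolding unif_closure_def
proof (intro CollectI allI impI)
  fix e :: real assume "e > 0"
  then have e2: "e/2 > 0" by simp
  obtain g where g: "g \<in> unif_closure S F" "\<forall>x\<in>S. \<bar>f x - g x\<bar> < e/2" using assms[OF e2] by blast
  obtain h where h: "h \<in> F" "\<forall>x\<in>S. \<bar>g x - h x\<bar> < e/2" using g(1) e2 unfolding unif_closure_def by blast
  have "\<forall>x\<in>S. \<bar>f x - h x\<bar> < e"
  proof
    fix x assume "x \<in> S"
    then have "\<bar>f x - g x\<bar> < e/2" "\<bar>g x - h x\<bar> < e/2" using g h by auto
    then show "\<bar>f x - h x\<bar> < e" by linarith
  qed
  with h(1) show "\<exists>h\<in>F. \<forall>x\<in>S. \<bar>f x - h x\<bar> < e" by blast
qed

lemma unif_closure_nets_lincomb: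
  assumes "f \<in> unif_closure S (nets \<sigma> k)" "g \<in> unif_closure S (nets \<sigma> k)"
  shows "(\<lambda>x. a * f x + b * g x) \<in> unif_closure S (nets \<sigma> k)"
  unfolding unif_closure_def
proof (intro CollectI allI impI)
  fix e :: real assume e: "e > 0"
  define d where "d = e / (\<bar>a\<bar> + \<bar>b\<bar> + 1)"
  have d: "d > 0" unfolding d_def using e by (intro divide_pos_pos) auto
  obtain f' g' where fg: "f' \<in> nets \<sigma> k" "\<forall>x\<in>S. \<bar>f x - f' x\<bar> < d"
     "g' \<in> nets \<sigma> k" "\<forall>x\<in>S. \<bar>g x - g' x\<bar> < d"
    using assms d unfolding unif_closure_def by blast
  have "\<bar>(a * f x + b * g x) - (a * f' x + b * g' x)\<bar> < e" if "x \<in> S" for x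
  proof -
    have "(a * f x + b * g x) - (a * f' x + b * g' x) = a * (f x - f' x) + b * (g x - g' x)"
      by (simp add: algebra_simps)
    then have "\<bar>(a * f x + b * g x) - (a * f' x + b * g' x)\<bar> \<le> \<bar>a\<bar> * \<bar>f x - f' x\<bar> + \<bar>b\<bar> * \<bar>g x - g' x\<bar>"
      using abs_triangle_ineq[of "a * (f x - f' x)" "b * (g x - g' x)"] by (simp add: abs_mult)
    also have "\<dots> \<le> \<bar>a\<bar> * d + \<bar>b\<bar> * d"
      using fg that by (intro add_mono mult_left_mono) (auto intro: less_imp_le)
    also have "\<dots> < (\<bar>a\<bar> + \<bar>b\<bar> + 1) * d" using d by (simp add: algebra_simps)
    also have "\<dots> = e" unfolding d_def by simp
    finally show ?thesis .
  qed
  then show "\<exists>h\<in>nets \<sigma> k. \<forall>x\<in>S. \<bar>a * f x + b * g x - h x\<bar> < e"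
    using nets_lincomb[OF fg(1,3)] by (intro bexI[of _ "\<lambda>x. a * f' x + b * g' x"]) auto
qed

lemma unif_closure_nets_const: "(\<lambda>_. c) \<in> unif_closure S (nets \<sigma> k)"
  by (intro unif_closure_superset nets_const)

lemma unif_closure_nets_sum:
  assumes "finite I" "\<And>i. i \<in> I \<Longrightarrow> f i \<in> unif_closure S (nets \<sigma> k)"
  shows "(\<lambda>x. \<Sum>i\<in>I. a i * f i x) \<in> unif_closure S (nets \<sigma> k)"
  using assms
proof (induction I rule: finite_induct)
  case empty
  then show ?case by (simp add: unif_closure_nets_const)
next
  case (insert i I)
  have "(\<lambda>x. a i * f i x + 1 * (\<Sum>i\<in>I. a i * f i x)) \<in> unif_closure S (nets \<sigma> k)"
    using insert by (intro unif_closure_nets_lincomb) auto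
  then show ?case using insert by simp
qed

section \<open>The square function from a non-affine activation\<close>

text \<open>All rescalings and translations \<open>w * t + b\<close> are built in because averaging
  uses translates of \<open>g\<close>, and second difference quotients use \<open>g\<close> at
  shrinking scales around a chosen point.\<close>

definition shallow_limit :: "(real \<Rightarrow> real) \<Rightarrow> (real \<Rightarrow> real) \<Rightarrow> bool" where
  "shallow_limit \<sigma> g \<longleftrightarrow> continuous_on UNIV g \<and>
     (\<forall>S w b. bounded S \<longrightarrow> (\<lambda>t. g (w * t + b)) \<in> unif_closure S (nets \<sigma> 1))"

lemma continuous_on_translate:
  fixes g :: "real \<Rightarrow> real"
  assumes "continuous_on UNIV g"
  shows "continuous_on UNIV (\<lambda>t. g (t + h))"
proof -
  have "continuous_on UNIV (\<lambda>t. t + h)" by (rule continuous_on_add[OF continuous_on_id continuous_on_const])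
  with assms show ?thesis by (rule continuous_on_compose2) simp
qed

lemma shallow_limit_self:
  assumes "continuous_on UNIV \<sigma>"
  shows "shallow_limit \<sigma> \<sigma>"
proof -
  have "(\<lambda>t. \<sigma> (w * t + b)) \<in> nets \<sigma> 1" for w b
  proof -
    have "(\<lambda>t::real. w * t + b) \<in> nets \<sigma> 0"
      by (rule nets_0I) (rule bounded_linear_mult_right)
    from nets_act[OF this] show ?thesis by simp
  qed
  with assms show ?thesis unfolding shallow_limit_def by (simp add: unif_closure_superset)
qed

text \<open>\<open>G (t + h) - G t\<close> integrates \<open>g\<close> over a window, so it is a locally uniform limit of Riemann
  sums of translates of \<open>g\<close>.\<close>

lemma shallow_limit_average:
  assumes g: "shallow_limit \<sigma> g" and G: "\<And>t. (G has_real_derivative g t) (at t)" and h: "h > 0"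
  shows "shallow_limit \<sigma> (\<lambda>t. G (t + h) - G t)"
  unfolding shallow_limit_def
proof (intro conjI allI impI)
  have G_cont: "continuous_on UNIV G"
    by (intro continuous_at_imp_continuous_on ballI DERIV_isCont[OF G])
  show "continuous_on UNIV (\<lambda>t. G (t + h) - G t)"
    by (intro continuous_on_diff G_cont continuous_on_translate)
next
  fix S :: "real set" and w b :: real
  assume "bounded S"
  then obtain M where M: "\<And>t. t \<in> S \<Longrightarrow> \<bar>t\<bar> \<le> M" unfolding bounded_iff real_norm_def by blast
  \<comment> \<open>The interval \<open>{-R..R+h}\<close> contains every window of length
    \<open>h\<close> that starts at some \<open>w * t + b\<close> with \<open>t\<close> in
    \<open>S\<close>.\<close>
  define R where "R = \<bar>w\<bar> * \<bar>M\<bar> + \<bar>b\<bar>"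
  have R: "\<bar>w * t + b\<bar> \<le> R" if "t \<in> S" for t
  proof -
    have "\<bar>w * t + b\<bar> \<le> \<bar>w\<bar> * \<bar>t\<bar> + \<bar>b\<bar>" by (metis abs_mult abs_triangle_ineq)
    also have "\<bar>w\<bar> * \<bar>t\<bar> \<le> \<bar>w\<bar> * \<bar>M\<bar>" using M[OF that] by (intro mult_left_mono) auto
    finally show ?thesis by (simp add: R_def)
  qed
  show "(\<lambda>t. G (w * t + b + h) - G (w * t + b)) \<in> unif_closure S (nets \<sigma> 1)"
  proof (rule unif_closureI)
    fix e :: real assume e: "e > 0"
    have "uniformly_continuous_on {-R..R+h} g"
      using g unfolding shallow_limit_def
      by (intro compact_uniformly_continuous) (auto intro: continuous_on_subset)
    \<comment> \<open>The pieces of the Riemann sum have total length \<open>h\<close>, so an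
      oscillation of \<open>e / (2 * h)\<close> on each of them costs \<open>e / 2\<close>
      altogether.\<close>
    moreover have e2: "e / (2 * h) > 0" using e h by simp
    ultimately obtain d where d: "d > 0"
      "\<And>x y. x \<in> {-R..R+h} \<Longrightarrow> y \<in> {-R..R+h} \<Longrightarrow> \<bar>y - x\<bar> < d \<Longrightarrow> \<bar>g y - g x\<bar> < e / (2 * h)"
      unfolding uniformly_continuous_on_def dist_real_def by meson
    obtain n where n: "h / d < real n" using reals_Archimedean2 by blast
    have n0: "real n > 0" using n h d(1) by (smt (verit) divide_pos_pos)
    define p where "p = h / n"
    have p: "p > 0" "p < d" "real n * p = h" using n n0 h d(1) unfolding p_def by (auto simp: field_simps)
    have "(\<lambda>t. g (w * t + (b + real k * p))) \<in> unif_closure S (nets \<sigma> 1)" for k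
      using g \<open>bounded S\<close> unfolding shallow_limit_def by simp
    then have "(\<lambda>t. g (w * t + b + real k * p)) \<in> unif_closure S (nets \<sigma> 1)" for k
      by (simp add: add.assoc)
    then have mem: "(\<lambda>t. \<Sum>k<n. p * g (w * t + b + real k * p)) \<in> unif_closure S (nets \<sigma> 1)"
      by (intro unif_closure_nets_sum) auto
    have "\<bar>G (s + h) - G s - (\<Sum>k<n. p * g (s + real k * p))\<bar> < e" if s: "\<bar>s\<bar> \<le> R" for s
    proof -
      \<comment> \<open>The window integral telescopes over the grid, and the mean value theorem
        turns each increment of \<open>G\<close> into \<open>p * g z\<close> with \<open>z\<close>
        inside its piece.\<close>
      define a where "a k = G (s + real k * p)" for k
      have tel: "G (s + h) - G s = (\<Sum>k<n. a (Suc k) - a k)"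
        using sum_lessThan_telescope[of a n] p by (simp add: a_def)
      have piece: "\<bar>(a (Suc k) - a k) - p * g (s + real k * p)\<bar> \<le> p * (e / (2 * h))" if k: "k < n" for k
      proof -
        have "s + real k * p < s + real (Suc k) * p" using p by (simp add: algebra_simps)
        from MVT2[OF this, of G g] G obtain z where z: "s + real k * p < z" "z < s + real (Suc k) * p"
          "a (Suc k) - a k = p * g z" unfolding a_def by (auto simp: algebra_simps)
        have "real (Suc k) * p \<le> real n * p" using k p by (intro mult_right_mono) auto
        then have kk: "real (Suc k) * p \<le> h" using p by simp
        have k0: "0 \<le> real k * p" using p by simp
        have kS: "real (Suc k) * p = real k * p + p" by (simp add: algebra_simps)
        have "s + real k * p \<in> {-R..R+h}" "z \<in> {-R..R+h}" "\<bar>z - (s + real k * p)\<bar> < d"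
          unfolding atLeastAtMost_iff using z kk s p k0 kS by linarith+
        then have "\<bar>g z - g (s + real k * p)\<bar> < e / (2 * h)" by (rule d(2))
        then have "p * \<bar>g z - g (s + real k * p)\<bar> \<le> p * (e / (2 * h))"
          using p by (intro mult_left_mono) auto
        then show ?thesis unfolding z(3) using p by (simp add: abs_mult right_diff_distrib [symmetric])
      qed
      have "\<bar>G (s + h) - G s - (\<Sum>k<n. p * g (s + real k * p))\<bar>
        = \<bar>\<Sum>k<n. (a (Suc k) - a k) - p * g (s + real k * p)\<bar>"
        unfolding tel by (simp add: sum_subtractf)
      also have "\<dots> \<le> (\<Sum>k<n. p * (e / (2 * h)))"
        by (rule order_trans[OF sum_abs]) (intro sum_mono piece, simp)
      also have "\<dots> = (real n * p) * (e / (2 * h))" by simp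
      also have "\<dots> = e / 2" unfolding p(3) using h by simp
      finally show ?thesis using e by simp
    qed
    then show "\<exists>q\<in>unif_closure S (nets \<sigma> 1). \<forall>t\<in>S. \<bar>G (w * t + b + h) - G (w * t + b) - q t\<bar> < e"
      using mem R by (intro bexI[of _ "\<lambda>t. \<Sum>k<n. p * g (w * t + b + real k * p)"]) auto
  qed
qed

text \<open>The Lagrange remainder is stated for \<open>x\<close> of either sign, so that it serves
  both halves of a symmetric second difference.\<close>

lemma taylor_second_order:
  fixes f f' f'' :: "real \<Rightarrow> real"
  assumes "\<And>t. (f has_real_derivative f' t) (at t)" "\<And>t. (f' has_real_derivative f'' t) (at t)"
  obtains z where "\<bar>z\<bar> \<le> \<bar>x\<bar>" "f (b + x) = f b + f' b * x + f'' (b + z) / 2 * x\<^sup>2"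
proof -
  define D where "D m x = (if m = 0 then f (b + x) else if m = Suc 0 then f' (b + x) else f'' (b + x))"
    for m :: nat and x
  have "\<exists>t. \<bar>t\<bar> \<le> \<bar>x\<bar> \<and> f (b + x) = (\<Sum>m<2. D m 0 / (fact m) * x ^ m) + D 2 t / (fact 2) * x ^ 2"
  proof (rule Maclaurin_bi_le[where f = "\<lambda>x. f (b + x)"])
    show "\<forall>m t. m < 2 \<and> \<bar>t\<bar> \<le> \<bar>x\<bar> \<longrightarrow> (D m has_real_derivative D (Suc m) t) (at t)"
    proof (intro allI impI)
      fix m :: nat and t assume "m < 2 \<and> \<bar>t\<bar> \<le> \<bar>x\<bar>"
      then consider "m = 0" | "m = 1" by linarith
      then show "(D m has_real_derivative D (Suc m) t) (at t)"
      proof cases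
        case 1
        then have "D m = (\<lambda>x. f (x + b))" "D (Suc m) t = f' (t + b)" by (auto simp: D_def add.commute)
        then show ?thesis using assms(1)[of "t + b"] by (simp add: DERIV_shift)
      next
        case 2
        then have "D m = (\<lambda>x. f' (x + b))" "D (Suc m) t = f'' (t + b)" by (auto simp: D_def add.commute)
        then show ?thesis using assms(2)[of "t + b"] by (simp add: DERIV_shift)
      qed
    qed
  qed (simp add: D_def)
  then show ?thesis using that by (auto simp: D_def numeral_2_eq_2)
qed

text \<open>In \<open>(f (b + w * t) + f (b - w * t) - 2 * f b) / (w\<^sup>2 * f'' b)\<close> the
  constant and linear Taylor terms cancel. What remains is \<open>t\<^sup>2\<close> times a ratio of
  second derivatives, which tends to 1 as \<open>w\<close> tends to 0, uniformly for bounded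
  \<open>t\<close>.\<close>

lemma square_from_second_derivative:
  assumes f: "shallow_limit \<sigma> f"
    and d1: "\<And>t. (f has_real_derivative f' t) (at t)"
    and d2: "\<And>t. (f' has_real_derivative f'' t) (at t)"
    and c: "continuous_on UNIV f''" and nz: "f'' b \<noteq> 0" and S: "bounded S"
  shows "(\<lambda>t. t\<^sup>2) \<in> unif_closure S (nets \<sigma> 1)"
proof (rule unif_closureI)
  fix e :: real assume e: "e > 0"
  obtain R where R: "R > 0" "\<And>t. t \<in> S \<Longrightarrow> \<bar>t\<bar> \<le> R"
    using S unfolding bounded_pos real_norm_def by blast
  define D where "D = f'' b"
  have D: "\<bar>D\<bar> > 0" using nz D_def by simp
  \<comment> \<open>An oscillation \<eta> of \<open>f''\<close> causes the error
    \<open>\<eta> * R\<^sup>2 / \<bar>D\<bar>\<close>, which this choice makes equal to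
    \<open>e / 2\<close>.\<close>
  define \<eta> where "\<eta> = e * \<bar>D\<bar> / (2 * R\<^sup>2)"
  have \<eta>: "\<eta> > 0" unfolding \<eta>_def using e D R by simp
  have "isCont f'' b" using c by (simp add: continuous_on_eq_continuous_at)
  then obtain d where d: "d > 0" "\<And>x. \<bar>x - b\<bar> < d \<Longrightarrow> \<bar>f'' x - D\<bar> < \<eta>"
    using \<eta> unfolding continuous_at_eps_delta dist_real_def D_def by blast
  \<comment> \<open>For \<open>\<bar>t\<bar> \<le> R\<close> the points \<open>b + w * t\<close> and
    \<open>b - w * t\<close> stay within \<open>d / 2\<close> of \<open>b\<close>.\<close>
  define w where "w = d / (2 * R)"
  have w: "w > 0" unfolding w_def using d R by simp
  \<comment> \<open>The factors \<open>1 *\<close> and the constant \<open>f b\<close> as a separate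
    summand give \<open>q\<close> the shape of nested linear combinations expected by the closure
    rule.\<close>
  define q where "q t = 1 / (w\<^sup>2 * D) * (1 * f (w * t + b) + 1 * f ((-w) * t + b)) + (- 2 / (w\<^sup>2 * D)) * f b" for t
  have mem: "q \<in> unif_closure S (nets \<sigma> 1)" unfolding q_def
    using f S unfolding shallow_limit_def
    by (intro unif_closure_nets_lincomb unif_closure_nets_const) blast+
  have "\<bar>t\<^sup>2 - q t\<bar> < e" if t: "t \<in> S" for t
  proof -
    have wt: "\<bar>w * t\<bar> < d"
    proof -
      have "\<bar>w * t\<bar> = w * \<bar>t\<bar>" using w by (simp add: abs_mult)
      also have "\<dots> \<le> w * R" using R(2)[OF t] w by (intro mult_left_mono) auto
      also have "\<dots> = d / 2" unfolding w_def using R by simp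
      finally show ?thesis using d by linarith
    qed
    obtain y where y: "\<bar>y\<bar> \<le> \<bar>w * t\<bar>" "f (b + w * t) = f b + f' b * (w * t) + f'' (b + y) / 2 * (w * t)\<^sup>2"
      using taylor_second_order[OF d1 d2] by blast
    obtain z where z: "\<bar>z\<bar> \<le> \<bar>- (w * t)\<bar>" "f (b + - (w * t)) = f b + f' b * (- (w * t)) + f'' (b + z) / 2 * (- (w * t))\<^sup>2"
      using taylor_second_order[OF d1 d2] by blast
    have yz: "\<bar>f'' (b + y) - D\<bar> < \<eta>" "\<bar>f'' (b + z) - D\<bar> < \<eta>"
      using y z wt by (intro d(2); simp)+
    have "q t = (f (b + w * t) + f (b + - (w * t)) - 2 * f b) / (w\<^sup>2 * D)"
      unfolding q_def by (simp add: add.commute diff_divide_distrib)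
    also have "f (b + w * t) + f (b + - (w * t)) - 2 * f b = (f'' (b + y) + f'' (b + z)) / 2 * (w\<^sup>2 * t\<^sup>2)"
      unfolding y(2) z(2) by (simp add: algebra_simps power_mult_distrib)
    also have "\<dots> / (w\<^sup>2 * D) = (f'' (b + y) + f'' (b + z)) / (2 * D) * t\<^sup>2"
      using w D by (simp add: field_simps)
    finally have q: "q t = (f'' (b + y) + f'' (b + z)) / (2 * D) * t\<^sup>2" .
    have "t\<^sup>2 - q t = - ((f'' (b + y) - D) + (f'' (b + z) - D)) / (2 * D) * t\<^sup>2"
      unfolding q using D by (simp add: field_simps)
    then have "\<bar>t\<^sup>2 - q t\<bar> = \<bar>(f'' (b + y) - D) + (f'' (b + z) - D)\<bar> / (2 * \<bar>D\<bar>) * t\<^sup>2"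
      by (metis (no_types, opaque_lifting) abs_divide abs_minus_cancel abs_mult abs_numeral abs_power2)
    also have "\<dots> \<le> (2 * \<eta>) / (2 * \<bar>D\<bar>) * t\<^sup>2"
      using yz D by (intro mult_right_mono divide_right_mono) auto
    also have "\<dots> \<le> (2 * \<eta>) / (2 * \<bar>D\<bar>) * R\<^sup>2"
      using R(2)[OF t] R(1) \<eta> D by (intro mult_left_mono) (auto simp: abs_le_square_iff[symmetric])
    also have "\<dots> = e / 2" unfolding \<eta>_def using D R by (simp add: field_simps)
    finally show ?thesis using e by simp
  qed
  then show "\<exists>q\<in>unif_closure S (nets \<sigma> 1). \<forall>t\<in>S. \<bar>t\<^sup>2 - q t\<bar> < e" using mem by blast
qed

lemma continuous_antiderivative:
  fixes g :: "real \<Rightarrow> real"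
  assumes "continuous_on UNIV g"
  obtains G where "\<And>t. (G has_real_derivative g t) (at t)"
proof -
  have "\<exists>F. \<forall>x::real. -\<infinity> < ereal x \<longrightarrow> ereal x < \<infinity> \<longrightarrow> (F has_vector_derivative g x) (at x)"
    using assms by (intro einterval_antiderivative) (auto simp: continuous_on_eq_continuous_at)
  then show ?thesis using that by (auto simp: has_real_derivative_iff_has_vector_derivative)
qed

text \<open>Bootstrapping of regularity: integrating the functional equation in \<open>h\<close>
  expresses \<open>g\<close> through its antiderivative, so \<open>g\<close> is differentiable;
  differentiating the equation in \<open>h\<close> then shows that \<open>g'\<close> is
  constant.\<close>

lemma affine_if_second_differences_vanish:
  fixes g :: "real \<Rightarrow> real"
  assumes cont: "continuous_on UNIV g" and z: "\<And>t h. g (t + 2 * h) - 2 * g (t + h) + g t = 0"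
  shows "\<exists>a c. \<forall>t. g t = a * t + c"
proof -
  obtain G where G: "\<And>t. (G has_real_derivative g t) (at t)"
    using continuous_antiderivative[OF cont] by blast
  note G' = DERIV_chain'[OF _ G]
  \<comment> \<open>The equation in \<open>z\<close> says that
    \<open>G (t + 2 * h) / 2 - 2 * G (t + h) + h * g t\<close> has derivative 0 in \<open>h\<close>;
    its values at \<open>h = 1\<close> and \<open>h = 0\<close> are compared.\<close>
  have eq: "g t = 2 * G (t + 1) - G (t + 2) / 2 - 3 / 2 * G t" for t
  proof -
    have "((\<lambda>h. G (t + 2 * h) / 2 - 2 * G (t + h) + h * g t) has_real_derivative 0) (at h)" for h
      using z[of t h] by (auto intro!: derivative_eq_intros G' simp: algebra_simps)
    from DERIV_isconst_all[OF allI[OF this], of 1 0] show ?thesis by simp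
  qed
  define g' where "g' t = 2 * g (t + 1) - g (t + 2) / 2 - 3 / 2 * g t" for t
  have "((\<lambda>t. 2 * G (t + 1) - G (t + 2) / 2 - 3 / 2 * G t) has_real_derivative g' t) (at t)" for t
    unfolding g'_def by (auto intro!: derivative_eq_intros G' G)
  then have g': "(g has_real_derivative g' t) (at t)" for t
    using eq by presburger
  have "g' (t + 2 * h) = g' (t + h)" for t h
  proof -
    have "((\<lambda>h. g (t + 2 * h) - 2 * g (t + h) + g t) has_real_derivative 2 * g' (t + 2 * h) - 2 * g' (t + h)) (at h)"
      by (auto intro!: derivative_eq_intros DERIV_chain'[OF _ g'])
    moreover have "((\<lambda>h. g (t + 2 * h) - 2 * g (t + h) + g t) has_real_derivative 0) (at h)"
      unfolding z by simp
    ultimately show ?thesis using DERIV_unique by fastforce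
  qed
  \<comment> \<open>With base point \<open>-t\<close> and step \<open>t\<close> the two arguments
    become \<open>t\<close> and 0.\<close>
  from this[of "- t" t for t] have g'0: "g' t = g' 0" for t by (simp add: algebra_simps)
  have "((\<lambda>t. g t - g' 0 * t) has_real_derivative 0) (at t)" for t
    using g'0[of t] by (auto intro!: derivative_eq_intros g')
  from DERIV_isconst_all[OF allI[OF this], of _ 0]
  have "g t = g' 0 * t + g 0" for t by (smt (verit) mult_zero_right)
  then show ?thesis by blast
qed

text \<open>The twice averaged activation is the second difference of a second antiderivative
  \<open>H\<close> of \<sigma>, so its second derivative is the second difference of \<sigma>
  itself. A function that is not affine has a nonzero one at some \<open>b\<close> and
  \<open>h\<close>.\<close>

lemma square_shallow_limit:
  assumes cont: "continuous_on UNIV \<sigma>" and na: "\<not> (\<exists>a c. \<forall>t. \<sigma> t = a * t + c)" and S: "bounded S"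
  shows "(\<lambda>t. t\<^sup>2) \<in> unif_closure S (nets \<sigma> 1)"
proof -
  have "\<exists>b h. h > 0 \<and> \<sigma> (b + 2 * h) - 2 * \<sigma> (b + h) + \<sigma> b \<noteq> 0"
  proof (rule ccontr)
    assume "\<not> ?thesis"
    then have pos: "\<sigma> (t + 2 * h) - 2 * \<sigma> (t + h) + \<sigma> t = 0" if "h > 0" for t h using that by blast
    have "\<sigma> (t + 2 * h) - 2 * \<sigma> (t + h) + \<sigma> t = 0" for t h
    proof (cases h "0::real" rule: linorder_cases)
      case less
      \<comment> \<open>A second difference is symmetric: step \<open>-h\<close> from the right end
        visits the same three points.\<close>
      then show ?thesis using pos[of "- h" "t + 2 * h"] by (simp add: algebra_simps)
    qed (use pos in auto)
    then show False using affine_if_second_differences_vanish[OF cont] na by blast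
  qed
  then obtain b h where h: "h > 0" and nz: "\<sigma> (b + 2 * h) - 2 * \<sigma> (b + h) + \<sigma> b \<noteq> 0" by blast
  obtain G where G: "\<And>t. (G has_real_derivative \<sigma> t) (at t)"
    using continuous_antiderivative[OF cont] by blast
  then have "continuous_on UNIV G"
    by (intro continuous_at_imp_continuous_on ballI DERIV_isCont)
  then obtain H where H: "\<And>t. (H has_real_derivative G t) (at t)"
    using continuous_antiderivative by blast
  note G' = DERIV_chain'[OF _ G] and H' = DERIV_chain'[OF _ H]
  have 1: "shallow_limit \<sigma> (\<lambda>t. G (t + h) - G t)"
    by (rule shallow_limit_average[OF shallow_limit_self[OF cont] G h])
  have 2: "((\<lambda>t. H (t + h) - H t) has_real_derivative G (t + h) - G t) (at t)" for t
    by (auto intro!: derivative_eq_intros H' H)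
  have 3: "shallow_limit \<sigma> (\<lambda>t. (H (t + h + h) - H (t + h)) - (H (t + h) - H t))"
    by (rule shallow_limit_average[OF 1 2 h])
  show ?thesis
  proof (rule square_from_second_derivative[OF 3 _ _ _ _ S])
    show "((\<lambda>t. (H (t + h + h) - H (t + h)) - (H (t + h) - H t)) has_real_derivative
       (G (t + h + h) - G (t + h)) - (G (t + h) - G t)) (at t)" for t
      by (auto intro!: derivative_eq_intros H' H)
    show "((\<lambda>t. (G (t + h + h) - G (t + h)) - (G (t + h) - G t)) has_real_derivative
       (\<sigma> (t + h + h) - \<sigma> (t + h)) - (\<sigma> (t + h) - \<sigma> t)) (at t)" for t
      by (auto intro!: derivative_eq_intros G' G)
    show "continuous_on UNIV (\<lambda>t. (\<sigma> (t + h + h) - \<sigma> (t + h)) - (\<sigma> (t + h) - \<sigma> t))"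
      using continuous_on_translate[OF cont, of "h + h"]
      by (intro continuous_on_diff cont continuous_on_translate[OF cont]) (simp add: add.assoc)
    show "(\<sigma> (b + h + h) - \<sigma> (b + h)) - (\<sigma> (b + h) - \<sigma> b) \<noteq> 0"
      using nz by (simp add: algebra_simps)
  qed
qed

section \<open>Products, polynomials and density\<close>

lemma unif_closure_nets_square:
  assumes cont: "continuous_on UNIV \<sigma>" and na: "\<not> (\<exists>a c. \<forall>t. \<sigma> t = a * t + c)"
    and f: "f \<in> unif_closure S (nets \<sigma> k)" and bd: "bounded (f ` S)"
  shows "(\<lambda>x. (f x)\<^sup>2) \<in> unif_closure S (nets \<sigma> (Suc k))"
  unfolding unif_closure_def
proof (intro CollectI allI impI)
  fix e :: real assume e: "e > 0"
  obtain R where R: "\<And>x. x \<in> S \<Longrightarrow> \<bar>f x\<bar> \<le> R"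
    using bd unfolding bounded_pos real_norm_def by blast
  \<comment> \<open>The margin 1 keeps the values of the approximant \<open>g\<close> inside the
    interval on which \<open>s\<close> is close to the square.\<close>
  define I where "I = {- (R + 1)..R + 1}"
  have "(\<lambda>t. t\<^sup>2) \<in> unif_closure I (nets \<sigma> 1)"
    using square_shallow_limit[OF cont na] by (simp add: I_def)
  then obtain s where s: "s \<in> nets \<sigma> 1" "\<And>t. t \<in> I \<Longrightarrow> \<bar>t\<^sup>2 - s t\<bar> < e / 2"
    using e by (elim unif_closureE[where e = "e / 2"]) auto
  have "uniformly_continuous_on I (\<lambda>t. t\<^sup>2 :: real)"
    unfolding I_def by (intro compact_uniformly_continuous continuous_intros) auto
  then obtain d where d: "d > 0" "\<And>x y. x \<in> I \<Longrightarrow> y \<in> I \<Longrightarrow> \<bar>x - y\<bar> < d \<Longrightarrow> \<bar>x\<^sup>2 - y\<^sup>2\<bar> < e / 2"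
    unfolding uniformly_continuous_on_def dist_real_def using e
    by (metis abs_minus_commute half_gt_zero)
  obtain g where g: "g \<in> nets \<sigma> k" "\<And>x. x \<in> S \<Longrightarrow> \<bar>f x - g x\<bar> < min d 1"
    using f d by (elim unif_closureE[where e = "min d 1"]) auto
  have "\<bar>(f x)\<^sup>2 - s (g x)\<bar> < e" if x: "x \<in> S" for x
  proof -
    have I: "f x \<in> I" "g x \<in> I" using R[OF x] g(2)[OF x] unfolding I_def by auto
    have "\<bar>(f x)\<^sup>2 - (g x)\<^sup>2\<bar> < e / 2" using I g(2)[OF x] by (intro d(2)) auto
    with s(2)[OF I(2)] show ?thesis by linarith
  qed
  then show "\<exists>g\<in>nets \<sigma> (Suc k). \<forall>x\<in>S. \<bar>(f x)\<^sup>2 - g x\<bar> < e"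
    using nets_comp[OF s(1) g(1)] by (intro bexI[of _ "\<lambda>x. s (g x)"]) auto
qed

text \<open>Polarisation: \<open>f * g\<close> is a quarter of
  \<open>(f + g)\<^sup>2 - (f - g)\<^sup>2\<close>.\<close>

lemma unif_closure_nets_mult:
  assumes cont: "continuous_on UNIV \<sigma>" and na: "\<not> (\<exists>a c. \<forall>t. \<sigma> t = a * t + c)"
    and f: "f \<in> unif_closure S (nets \<sigma> k)" "bounded (f ` S)"
    and g: "g \<in> unif_closure S (nets \<sigma> k)" "bounded (g ` S)"
  shows "(\<lambda>x. f x * g x) \<in> unif_closure S (nets \<sigma> (Suc k))"
proof -
  have "(\<lambda>x. (1 * f x + c * g x)\<^sup>2) \<in> unif_closure S (nets \<sigma> (Suc k))" for c
  proof (intro unif_closure_nets_square[OF cont na] unif_closure_nets_lincomb f g)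
    have "bounded ((\<lambda>x. c * g x) ` S)"
      using bounded_scaling[OF g(2), of c] by (simp add: image_image)
    then show "bounded ((\<lambda>x. 1 * f x + c * g x) ` S)"
      using bounded_plus_comp[OF f(2)] by simp
  qed
  from unif_closure_nets_lincomb[OF this[of 1] this[of "-1"], of "1/4" "-1/4"]
  show ?thesis by (simp add: power2_eq_square field_simps)
qed

text \<open>An activation cannot in general copy its input exactly, so depth is padded only in the
  limit: multiplication by the constant 1 costs one level. This brings summands and factors of
  different depth to a common level.\<close>

lemma unif_closure_nets_mono:
  assumes cont: "continuous_on UNIV \<sigma>" and na: "\<not> (\<exists>a c. \<forall>t. \<sigma> t = a * t + c)"
    and f: "f \<in> unif_closure S (nets \<sigma> k)" "bounded (f ` S)" and "k \<le> l"
  shows "f \<in> unif_closure S (nets \<sigma> l)"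
  using \<open>k \<le> l\<close>
proof (induction l rule: dec_induct)
  case (step l)
  have "bounded ((\<lambda>_. 1::real) ` S)" by (rule finite_imp_bounded) (auto simp: image_constant_conv)
  from unif_closure_nets_mult[OF cont na step.IH f(2) unif_closure_nets_const[of 1] this]
  show ?case by simp
qed (rule f(1))

theorem deep_nets_dense:
  fixes f :: "'a::euclidean_space \<Rightarrow> real"
  assumes cont: "continuous_on UNIV \<sigma>" and na: "\<not> (\<exists>a c. \<forall>t. \<sigma> t = a * t + c)"
    and S: "compact S" and f: "continuous_on S f" and e: "e > 0"
  shows "\<exists>k g. g \<in> nets \<sigma> (Suc k) \<and> (\<forall>x\<in>S. \<bar>f x - g x\<bar> < e)"
proof -
  have bd: "bounded (p ` S)" if "real_polynomial_function p" for p :: "'a \<Rightarrow> real"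
    using that S by (intro compact_imp_bounded compact_continuous_image continuous_on_polymonial_function)
      (auto simp: real_polynomial_function_eq)
  have pol: "\<exists>k. p \<in> unif_closure S (nets \<sigma> k)" if "real_polynomial_function p" for p :: "'a \<Rightarrow> real"
    using that
  proof (induction p rule: real_polynomial_function.induct)
    case (linear p)
    then have "p \<in> nets \<sigma> 0" using nets_0I[of p 0] by simp
    then show ?case by (blast intro: unif_closure_superset)
  next
    case (const c)
    then show ?case by (blast intro: unif_closure_nets_const)
  next
    case (add p q)
    then obtain k l where "p \<in> unif_closure S (nets \<sigma> k)" "q \<in> unif_closure S (nets \<sigma> l)" by blast
    then have "p \<in> unif_closure S (nets \<sigma> (max k l))" "q \<in> unif_closure S (nets \<sigma> (max k l))"
      using add bd by (auto intro: unif_closure_nets_mono[OF cont na])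
    from unif_closure_nets_lincomb[OF this, of 1 1] show ?case unfolding mult_1 by blast
  next
    case (mult p q)
    then obtain k l where "p \<in> unif_closure S (nets \<sigma> k)" "q \<in> unif_closure S (nets \<sigma> l)" by blast
    then have "p \<in> unif_closure S (nets \<sigma> (max k l))" "q \<in> unif_closure S (nets \<sigma> (max k l))"
      using mult bd by (auto intro: unif_closure_nets_mono[OF cont na])
    from unif_closure_nets_mult[OF cont na this(1) bd this(2) bd] mult show ?case by blast
  qed
  obtain p where p: "real_polynomial_function p" "\<And>x. x \<in> S \<Longrightarrow> \<bar>f x - p x\<bar> < e / 2"
    using Stone_Weierstrass_real_polynomial_function[OF S f, of "e / 2"] e by auto
  obtain k where "p \<in> unif_closure S (nets \<sigma> k)" using pol[OF p(1)] by blast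
  \<comment> \<open>At least one activation is enforced, since the first one is going to be the
    hidden layer of the operator.\<close>
  then have "p \<in> unif_closure S (nets \<sigma> (Suc k))"
    using bd[OF p(1)] by (rule unif_closure_nets_mono[OF cont na]) simp
  then obtain g where g: "g \<in> nets \<sigma> (Suc k)" "\<And>x. x \<in> S \<Longrightarrow> \<bar>p x - g x\<bar> < e / 2"
    using e by (elim unif_closureE[where e = "e / 2"]) auto
  have "\<bar>f x - g x\<bar> < e" if "x \<in> S" for x using p(2)[OF that] g(2)[OF that] by linarith
  with g(1) show ?thesis by (intro exI[of _ k] exI[of _ g]) simp
qed

section \<open>Realisation by matrices\<close>

text \<open>A matrix layer computes all its outputs from one list of neurons, so the neuron sets of
  the \<open>f i\<close> are pooled and enumerated, with zero weights where a neuron does not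
  occur.\<close>

lemma nets_common:
  fixes f :: "nat \<Rightarrow> 'a::real_normed_vector \<Rightarrow> real"
  assumes "\<And>i. i < q \<Longrightarrow> f i \<in> nets \<sigma> (Suc k)"
  shows "\<exists>r g c a. 0 < (r::nat) \<and> (\<forall>j<r. g j \<in> nets \<sigma> k) \<and>
    (\<forall>i<q. \<forall>x. f i x = c i + (\<Sum>j<r. a i j * \<sigma> (g j x)))"
proof -
  have "\<exists>T. i < q \<longrightarrow> finite (fst (snd T)) \<and> fst (snd T) \<subseteq> nets \<sigma> k \<and>
      f i = (\<lambda>x. fst T + (\<Sum>g\<in>fst (snd T). snd (snd T) g * \<sigma> (g x)))" for i
  proof (cases "i < q")
    case True
    obtain c G a where "finite G" "G \<subseteq> nets \<sigma> k" "f i = (\<lambda>x. c + (\<Sum>g\<in>G. a g * \<sigma> (g x)))"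
      using assms[OF True] by (rule nets_SucE)
    then show ?thesis by (intro exI[of _ "(c, G, a)"]) simp
  qed simp
  from choice[OF allI, OF this] obtain T where T: "\<forall>i. i < q \<longrightarrow> finite (fst (snd (T i))) \<and> fst (snd (T i)) \<subseteq> nets \<sigma> k \<and>
      f i = (\<lambda>x. fst (T i) + (\<Sum>g\<in>fst (snd (T i)). snd (snd (T i)) g * \<sigma> (g x)))"
    by (rule exE)
  define c G a where cGa: "c i = fst (T i)" "G i = fst (snd (T i))" "a i = snd (snd (T i))" for i
  have *: "\<And>i. i < q \<Longrightarrow> finite (G i)" "\<And>i. i < q \<Longrightarrow> G i \<subseteq> nets \<sigma> k"
    "\<And>i. i < q \<Longrightarrow> f i = (\<lambda>x. c i + (\<Sum>g\<in>G i. a i g * \<sigma> (g x)))"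
    using T unfolding cGa by simp_all
  \<comment> \<open>The zero neuron makes the width positive even if every \<open>G i\<close> is
    empty; \<open>neural_operator\<close> demands positive widths.\<close>
  define H where "H = insert (\<lambda>_. 0) (\<Union>i<q. G i)"
  have H: "finite H" "H \<subseteq> nets \<sigma> k" unfolding H_def using * by (auto simp: nets_const)
  obtain h where h: "bij_betw h {..<card H} H"
    using ex_bij_betw_nat_finite[OF H(1)] by (auto simp: atLeast0LessThan)
  show ?thesis
  proof (intro exI conjI allI impI)
    show "0 < card H" using H unfolding H_def by (simp add: card_gt_0_iff)
    show "h j \<in> nets \<sigma> k" if "j < card H" for j
      using h H that by (auto simp: bij_betw_def)
    show "f i x = c i + (\<Sum>j<card H. (if h j \<in> G i then a i (h j) else 0) * \<sigma> (h j x))" if i: "i < q" for i x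
    proof -
      have "(\<Sum>j<card H. (if h j \<in> G i then a i (h j) else 0) * \<sigma> (h j x))
          = (\<Sum>g\<in>H. (if g \<in> G i then a i g else 0) * \<sigma> (g x))"
        using sum.reindex_bij_betw[OF h, of "\<lambda>g. (if g \<in> G i then a i g else 0) * \<sigma> (g x)"] by simp
      also have "\<dots> = (\<Sum>g\<in>G i. a i g * \<sigma> (g x))"
        using H i by (intro sum.mono_neutral_cong_right) (auto simp: H_def)
      finally show ?thesis using *(3)[OF i] by simp
    qed
  qed
qed

lemma affine_vec_eq:
  "Matrix.mat q r (\<lambda>(i, j). a i j) *\<^sub>v Matrix.vec r w + Matrix.vec q c
     = Matrix.vec q (\<lambda>i. c i + (\<Sum>j<r. a i j * (w j :: real)))"
  by (intro eq_vecI) (auto simp: scalar_prod_def atLeast0LessThan)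

text \<open>The first \<open>p\<close> columns vanish: this is how a lifting or projection network
  ignores the coordinates of the point and reads only the field value.\<close>

lemma affine_append_eq:
  assumes "z \<in> carrier_vec p"
  shows "Matrix.mat q (p + r) (\<lambda>(i, j). if j < p then 0 else a i (j - p)) *\<^sub>v (z @\<^sub>v Matrix.vec r w) + Matrix.vec q c
     = Matrix.vec q (\<lambda>i. c i + (\<Sum>j<r. a i j * (w j :: real)))"
proof (intro eq_vecI)
  fix i assume "i < dim_vec (Matrix.vec q (\<lambda>i. c i + (\<Sum>j<r. a i j * w j)))"
  then have i: "i < q" by simp
  let ?A = "Matrix.mat q (p + r) (\<lambda>(i, j). if j < p then 0 else a i (j - p))"
  have "Matrix.row ?A i = 0\<^sub>v p @\<^sub>v Matrix.vec r (a i)" using i by (intro eq_vecI) auto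
  moreover have "(0\<^sub>v p @\<^sub>v Matrix.vec r (a i)) \<bullet> (z @\<^sub>v Matrix.vec r w) = 0\<^sub>v p \<bullet> z + Matrix.vec r (a i) \<bullet> Matrix.vec r w"
    using assms by (intro scalar_prod_append) auto
  ultimately show "vec_index (?A *\<^sub>v (z @\<^sub>v Matrix.vec r w) + Matrix.vec q c) i = vec_index (Matrix.vec q (\<lambda>i. c i + (\<Sum>j<r. a i j * w j))) i"
    using i assms by (simp add: scalar_prod_def[of "Matrix.vec r (a i)"] atLeast0LessThan)
qed simp

text \<open>The innermost activation layer is split off in the explicit form
  \<open>\<sigma> (\<alpha> i * u + \<beta> i * v + \<gamma> i)\<close>, because the hidden layer
  will supply it; \<open>Q\<close> is the remainder and ignores \<open>z\<close>. The output width
  \<open>q\<close> is kept general since the induction passes from a family of outputs to the family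
  of neurons feeding it.\<close>

lemma nets_realised:
  fixes f :: "nat \<Rightarrow> real \<times> real \<Rightarrow> real"
  assumes "\<And>i. i < q \<Longrightarrow> f i \<in> nets \<sigma> (Suc k)"
  shows "\<exists>n Q \<alpha> \<beta> \<gamma>. 0 < n \<and> neural_network \<sigma> (p + n) q Q \<and>
    (\<forall>u v z. z \<in> carrier_vec p \<longrightarrow>
       Q (z @\<^sub>v Matrix.vec n (\<lambda>i. \<sigma> (\<alpha> i * u + \<beta> i * v + \<gamma> i))) = Matrix.vec q (\<lambda>i. f i (u, v)))"
  using assms
proof (induction k arbitrary: q f)
  case 0
  obtain r :: nat and g c a where r: "0 < r" "\<forall>j<r. g j \<in> nets \<sigma> 0"
    "\<forall>i<q. \<forall>x. f i x = c i + (\<Sum>j<r. a i j * \<sigma> (g j x))"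
    by atomize_elim (rule nets_common[OF 0])
  \<comment> \<open>An affine function on the plane is determined by its values at the origin and at
    the two unit vectors.\<close>
  define \<gamma> where "\<gamma> j = g j (0, 0)" for j
  define \<alpha> where "\<alpha> j = g j (1, 0) - \<gamma> j" for j
  define \<beta> where "\<beta> j = g j (0, 1) - \<gamma> j" for j
  have g: "g j (u, v) = \<alpha> j * u + \<beta> j * v + \<gamma> j" if j: "j < r" for j u v
  proof -
    obtain l d where l: "bounded_linear l" "g j = (\<lambda>x. l x + d)" using r(2)[rule_format, OF j] by (rule nets_0E)
    interpret l: bounded_linear l by (rule l(1))
    have "l (u, v) = l (u *\<^sub>R (1, 0) + v *\<^sub>R (0, 1))" by simp
    also have "\<dots> = u * l (1, 0) + v * l (0, 1)" by (simp only: l.add l.scaleR real_scaleR_def)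
    finally show ?thesis using l.zero by (simp add: \<alpha>_def \<beta>_def \<gamma>_def l(2) zero_prod_def)
  qed
  let ?A = "Matrix.mat q (p + r) (\<lambda>(i, j). if j < p then 0 else a i (j - p))"
  show ?case
  proof (intro exI conjI allI impI)
    show "neural_network \<sigma> (p + r) q (\<lambda>x. ?A *\<^sub>v x + Matrix.vec q c)"
      by (rule neural_network.affine) auto
    fix u v :: real and z :: "real Matrix.vec" assume "z \<in> carrier_vec p"
    from affine_append_eq[OF this]
    show "?A *\<^sub>v (z @\<^sub>v Matrix.vec r (\<lambda>i. \<sigma> (\<alpha> i * u + \<beta> i * v + \<gamma> i))) + Matrix.vec q c = Matrix.vec q (\<lambda>i. f i (u, v))"
      by (auto simp: r(3) g intro!: eq_vecI)
  qed (rule r(1))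
next
  case (Suc k)
  obtain r :: nat and g c a where r: "0 < r" "\<forall>j<r. g j \<in> nets \<sigma> (Suc k)"
    "\<forall>i<q. \<forall>x. f i x = c i + (\<Sum>j<r. a i j * \<sigma> (g j x))"
    by atomize_elim (rule nets_common[OF Suc.prems])
  obtain n Q \<alpha> \<beta> \<gamma> where Q: "0 < n" "neural_network \<sigma> (p + n) r Q"
    "\<forall>u v z. z \<in> carrier_vec p \<longrightarrow>
       Q (z @\<^sub>v Matrix.vec n (\<lambda>i. \<sigma> (\<alpha> i * u + \<beta> i * v + \<gamma> i))) = Matrix.vec r (\<lambda>i. g i (u, v))"
    by atomize_elim (rule Suc.IH[OF r(2)[rule_format]])
  let ?A = "Matrix.mat q r (\<lambda>(i, j). a i j)"
  show ?case
  proof (intro exI conjI allI impI)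
    show "neural_network \<sigma> (p + n) q (\<lambda>x. ?A *\<^sub>v map_vec \<sigma> (Q x) + Matrix.vec q c)"
      by (rule neural_network.layer[OF Q(2)]) auto
    fix u v :: real and z :: "real Matrix.vec" assume z: "z \<in> carrier_vec p"
    have "map_vec \<sigma> (Matrix.vec r (\<lambda>i. g i (u, v))) = Matrix.vec r (\<lambda>i. \<sigma> (g i (u, v)))" by auto
    then show "?A *\<^sub>v map_vec \<sigma> (Q (z @\<^sub>v Matrix.vec n (\<lambda>i. \<sigma> (\<alpha> i * u + \<beta> i * v + \<gamma> i)))) + Matrix.vec q c
       = Matrix.vec q (\<lambda>i. f i (u, v))"
      by (auto simp: Q(3)[rule_format, OF z] affine_vec_eq r(3) intro!: eq_vecI)
  qed (rule Q(1))
qed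

text \<open>Continuity is expressed componentwise along a family \<open>g x\<close> of inputs, which
  is the form in which the projection layer meets a network.\<close>

lemma neural_network_continuous:
  assumes "neural_network \<sigma> p q N" and \<sigma>: "continuous_on UNIV \<sigma>"
    and "\<And>x. x \<in> S \<Longrightarrow> g x \<in> carrier_vec p" and "\<And>i. i < p \<Longrightarrow> continuous_on S (\<lambda>x. vec_index (g x) i)"
  shows "(\<forall>x\<in>S. N (g x) \<in> carrier_vec q) \<and> (\<forall>i<q. continuous_on S (\<lambda>x. vec_index (N (g x)) i))"
proof -
  have aff: "(\<forall>x\<in>S. A *\<^sub>v h x + b \<in> carrier_vec q) \<and> (\<forall>i<q. continuous_on S (\<lambda>x. vec_index (A *\<^sub>v h x + b) i))"
    if A: "A \<in> carrier_mat q n" "b \<in> carrier_vec q" and h: "\<And>x. x \<in> S \<Longrightarrow> h x \<in> carrier_vec n"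
      "\<And>i. i < n \<Longrightarrow> continuous_on S (\<lambda>x. vec_index (h x) i)" for A and b :: "real Matrix.vec" and q n h
  proof (intro conjI ballI allI impI)
    show "A *\<^sub>v h x + b \<in> carrier_vec q" for x using A by (intro carrier_vecI) auto
    fix i assume i: "i < q"
    have "continuous_on S (\<lambda>x. (\<Sum>j<n. A $$ (i, j) * vec_index (h x) j) + vec_index b i)"
      using h by (intro continuous_intros) auto
    moreover have "vec_index (A *\<^sub>v h x + b) i = (\<Sum>j<n. A $$ (i, j) * vec_index (h x) j) + vec_index b i" if "x \<in> S" for x
      using A h(1)[OF that] i by (auto simp: scalar_prod_def atLeast0LessThan intro!: sum.cong)
    ultimately show "continuous_on S (\<lambda>x. vec_index (A *\<^sub>v h x + b) i)"
      by (simp cong: continuous_on_cong)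
  qed
  from assms(1,3,4) show ?thesis
  proof induction
    case (affine A q p b)
    then show ?case by (intro aff) auto
  next
    case (layer p n N A q b)
    note IH = layer.IH[OF layer.prems]
    have "continuous_on S (\<lambda>x. vec_index (map_vec \<sigma> (N (g x))) i)" if i: "i < n" for i
    proof -
      have "continuous_on S (\<lambda>x. \<sigma> (vec_index (N (g x)) i))"
        using IH i by (intro continuous_on_compose2[OF \<sigma>]) auto
      moreover have "vec_index (map_vec \<sigma> (N (g x))) i = \<sigma> (vec_index (N (g x)) i)" if "x \<in> S" for x
        using IH i that by auto
      ultimately show ?thesis by (simp cong: continuous_on_cong)
    qed
    with layer.hyps IH show ?case by (intro aff[of _ _ n]) auto
  qed
qed

section \<open>Finite-rank approximation of the marginal\<close>

text \<open>Near a boundary point the strict epigraph is open and accumulates at that point, so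
  every ball around a point of \<open>S\<close> meets \<open>S\<close> in a set with a nonempty open
  subset.\<close>

lemma lipschitz_boundary_measure_pos:
  fixes S :: "'a::euclidean_space set"
  assumes S: "compact S" "lipschitz_boundary S" and p: "p \<in> S" and r: "0 < r"
  shows "0 < measure lborel (S \<inter> ball p r)"
proof -
  have "\<exists>G. open G \<and> G \<noteq> {} \<and> G \<subseteq> S \<inter> ball p r"
  proof (cases "p \<in> interior S")
    case True
    then show ?thesis using r interior_subset[of S]
      by (intro exI[of _ "interior S \<inter> ball p r"]) auto
  next
    case False
    then have pf: "p \<in> frontier S" using p S by (simp add: frontier_def compact_imp_closed)
    obtain U v \<gamma> C where U: "open U" "p \<in> U" "norm v = 1" "C-lipschitz_on {w. inner w v = 0} \<gamma>"
      "S \<inter> U = {x \<in> U. \<gamma> (x - inner x v *\<^sub>R v) \<le> inner x v}"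
      using bspec[OF S(2)[unfolded lipschitz_boundary_def] pf] by (elim exE conjE) (rule that)
    have vv: "inner v v = 1" using U(3) by (simp add: dot_square_norm)
    define g where "g x = \<gamma> (x - inner x v *\<^sub>R v)" for x
    have "continuous_on UNIV g" unfolding g_def
      by (rule continuous_on_compose2[OF lipschitz_on_continuous_on[OF U(4)]])
         (auto intro!: continuous_intros simp: inner_diff_left vv)
    then have W: "open {x. g x < inner x v}" by (intro open_Collect_less continuous_intros) auto
    define G where "G = (U \<inter> ball p r) \<inter> {x. g x < inner x v}"
    have "open G" unfolding G_def using W U(1) by auto
    moreover have "G \<subseteq> S \<inter> ball p r"
    proof
      fix x assume x: "x \<in> G"
      then have "x \<in> {x \<in> U. \<gamma> (x - inner x v *\<^sub>R v) \<le> inner x v}"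
        unfolding G_def g_def by simp
      then have "x \<in> S" unfolding U(5)[symmetric] by simp
      with x show "x \<in> S \<inter> ball p r" unfolding G_def by simp
    qed
    moreover have "G \<noteq> {}"
    proof -
      obtain s where s: "s > 0" "ball p s \<subseteq> U \<inter> ball p r"
        using U(1,2) r by (metis IntI centre_in_ball open_Int open_ball open_contains_ball)
      \<comment> \<open>Moving along \<open>v\<close> leaves the projection to the hyperplane
        unchanged, and hence \<open>g\<close>, but raises the height strictly above the
        graph.\<close>
      define x where "x = p + (s / 2) *\<^sub>R v"
      have "dist p x < s" unfolding x_def dist_norm using U(3) s by simp
      then have x: "x \<in> U \<inter> ball p r" using s(2) by auto
      have "g x = g p" unfolding g_def x_def by (simp add: inner_add_left vv algebra_simps)
      moreover have "g p \<le> inner p v"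
      proof -
        have "p \<in> S \<inter> U" using U(2) p by simp
        then show ?thesis unfolding U(5) g_def by simp
      qed
      moreover have "inner x v = inner p v + s / 2" unfolding x_def by (simp add: inner_add_left vv)
      ultimately have "g x < inner x v" using s by simp
      with x show ?thesis unfolding G_def by blast
    qed
    ultimately show ?thesis by blast
  qed
  then obtain G where G: "open G" "G \<noteq> {}" "G \<subseteq> S \<inter> ball p r" by blast
  have m: "S \<inter> ball p r \<in> sets lborel" using S(1) by (auto simp: compact_imp_closed)
  have f: "emeasure lborel (S \<inter> ball p r) < \<infinity>"
    using S(1) by (intro emeasure_bounded_finite) (auto intro: bounded_Int compact_imp_bounded)
  show ?thesis
  proof (rule ccontr)
    assume "\<not> ?thesis"
    then have "measure lborel (S \<inter> ball p r) = 0" using measure_nonneg by (metis order_le_imp_less_or_eq)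
    then have "emeasure lborel (S \<inter> ball p r) = 0" 
      using emeasure_eq_ennreal_measure[OF less_imp_neq[OF f[unfolded infinity_ennreal_def]]] by simp
    then have "S \<inter> ball p r \<in> null_sets lborel" using m by (intro null_setsI)
    then have "negligible (S \<inter> ball p r)"
      by (simp add: negligible_iff_null_sets null_sets_completionI)
    then show False using G open_not_negligible negligible_subset by blast
  qed
qed

section \<open>Compact sets of continuous functions\<close>

lemma mem_cont_space:
  assumes "compact S"
  shows "f \<in> mspace (cont_space S) \<longleftrightarrow> f \<in> extensional S \<and> continuous_on S f"
  using assms by (subst compactin_mspace_cfunspace) (auto simp: compactin_subtopology)

lemma cont_space_mdist_lt:
  assumes "compact S" "f \<in> mspace (cont_space S)" "g \<in> mspace (cont_space S)"
    "mdist (cont_space S) f g < a" "x \<in> S"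
  shows "\<bar>f x - g x\<bar> < a"
  using cfunspace_mdist_lt[of "top_of_set S" f euclidean_metric g a x] assms
  by (simp add: compactin_subtopology dist_real_def)

text \<open>Total boundedness with centres in \<open>K\<close>: equicontinuity and boundedness of
  \<open>K\<close> are then inherited from finitely many continuous functions.\<close>

lemma compactin_cont_space_net:
  assumes S: "compact S" and K: "compactin (mtopology_of (cont_space S)) K" and e: "e > 0"
  obtains F where "finite F" "F \<subseteq> K" "\<And>f. f \<in> K \<Longrightarrow> \<exists>g\<in>F. \<forall>x\<in>S. \<bar>f x - g x\<bar> < e"
proof -
  interpret Metric_space "mspace (cont_space S)" "mdist (cont_space S)"
    by (rule Metric_space_mspace_mdist)
  have "mtotally_bounded K"
    using K unfolding mtopology_of_def by (rule compactin_imp_mtotally_bounded)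
  then have "\<exists>F. finite F \<and> F \<subseteq> K \<and> K \<subseteq> (\<Union>g\<in>F. mball g e)"
    using e unfolding mtotally_bounded_def by simp
  then obtain F where F: "finite F" "F \<subseteq> K" "K \<subseteq> (\<Union>g\<in>F. mball g e)"
    by (elim exE conjE)
  show ?thesis
  proof (rule that[OF F(1,2)])
    fix f assume "f \<in> K"
    then obtain g where g: "g \<in> F" "f \<in> mball g e" using F(3) by blast
    then have gf: "g \<in> mspace (cont_space S)" "f \<in> mspace (cont_space S)"
      "mdist (cont_space S) g f < e" unfolding in_mball by (simp_all only:)
    have "\<forall>x\<in>S. \<bar>f x - g x\<bar> < e"
      using cont_space_mdist_lt[OF S gf] by (metis abs_minus_commute)
    with g(1) show "\<exists>g\<in>F. \<forall>x\<in>S. \<bar>f x - g x\<bar> < e" by blast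
  qed
qed

lemma compactin_cont_space_subset:
  "compactin (mtopology_of (cont_space S)) K \<Longrightarrow> K \<subseteq> mspace (cont_space S)"
  using compactin_subset_topspace by fastforce

text \<open>The easy half of the Arzela-Ascoli theorem, with an error of \<open>e / 3\<close> each
  for leaving \<open>f\<close>, moving along a net function, and returning to
  \<open>f\<close>.\<close>

lemma compactin_cont_space_equicontinuous:
  fixes S :: "'a::metric_space set"
  assumes S: "compact S" and K: "compactin (mtopology_of (cont_space S)) K" and e: "e > 0"
  obtains r where "r > 0" "\<And>f x y. f \<in> K \<Longrightarrow> x \<in> S \<Longrightarrow> y \<in> S \<Longrightarrow> dist x y < r \<Longrightarrow> \<bar>f x - f y\<bar> < e"
proof -
  have e3: "e / 3 > 0" using e by simp
  obtain F where F: "finite F" "F \<subseteq> K" "\<And>f. f \<in> K \<Longrightarrow> \<exists>g\<in>F. \<forall>x\<in>S. \<bar>f x - g x\<bar> < e / 3"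
    using compactin_cont_space_net[OF S K e3] by blast
  have "\<exists>r>0. \<forall>x\<in>S. \<forall>y\<in>S. dist x y < r \<longrightarrow> \<bar>g x - g y\<bar> < e / 3" if "g \<in> F" for g
  proof -
    have "continuous_on S g"
      using that F(2) compactin_cont_space_subset[OF K] mem_cont_space[OF S] by blast
    then have "uniformly_continuous_on S g" using S by (rule compact_uniformly_continuous)
    then obtain r where r: "r > 0" "\<forall>x\<in>S. \<forall>x'\<in>S. dist x' x < r \<longrightarrow> dist (g x') (g x) < e / 3"
      using e3 unfolding uniformly_continuous_on_def by blast
    then show ?thesis by (intro exI[of _ r]) (auto simp: dist_real_def)
  qed
  then obtain r where r: "\<And>g. g \<in> F \<Longrightarrow> r g > 0"
    "\<And>g x y. g \<in> F \<Longrightarrow> x \<in> S \<Longrightarrow> y \<in> S \<Longrightarrow> dist x y < r g \<Longrightarrow> \<bar>g x - g y\<bar> < e / 3" by metis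
  \<comment> \<open>The element 1 gives \<open>Min\<close> a value if the net is empty.\<close>
  define R where "R = Min (insert 1 (r ` F))"
  have R: "R > 0" "\<And>g. g \<in> F \<Longrightarrow> R \<le> r g" unfolding R_def using F(1) r(1) by auto
  show ?thesis
  proof (rule that[OF R(1)])
    fix f x y assume f: "f \<in> K" and xy: "x \<in> S" "y \<in> S" "dist x y < R"
    obtain g where g: "g \<in> F" "\<forall>x\<in>S. \<bar>f x - g x\<bar> < e / 3" using F(3)[OF f] by blast
    have "\<bar>g x - g y\<bar> < e / 3" using r(2)[OF g(1) xy(1,2)] xy(3) R(2)[OF g(1)] by linarith
    moreover have "\<bar>f x - g x\<bar> < e / 3" "\<bar>f y - g y\<bar> < e / 3" using g(2) xy by auto
    ultimately show "\<bar>f x - f y\<bar> < e" by linarith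
  qed
qed

lemma compactin_cont_space_bounded:
  assumes S: "compact S" and K: "compactin (mtopology_of (cont_space S)) K"
  obtains B where "B > 0" "\<And>f x. f \<in> K \<Longrightarrow> x \<in> S \<Longrightarrow> \<bar>f x\<bar> \<le> B"
proof -
  obtain F where F: "finite F" "F \<subseteq> K" "\<And>f. f \<in> K \<Longrightarrow> \<exists>g\<in>F. \<forall>x\<in>S. \<bar>f x - g x\<bar> < 1"
    using compactin_cont_space_net[OF S K, of 1] by auto
  have "bounded (g ` S)" if "g \<in> F" for g
    using that F(2) compactin_cont_space_subset[OF K] mem_cont_space[OF S] S
    by (intro compact_imp_bounded compact_continuous_image) auto
  then have "bounded (\<Union>g\<in>F. g ` S)" using F(1) by (intro bounded_UN) auto
  then obtain B where B: "B > 0" "\<forall>t\<in>(\<Union>g\<in>F. g ` S). \<bar>t\<bar> \<le> B"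
    unfolding bounded_pos real_norm_def by blast
  show ?thesis
  proof (rule that[of "B + 1"])
    fix f x assume f: "f \<in> K" and x: "x \<in> S"
    obtain g where g: "g \<in> F" "\<forall>x\<in>S. \<bar>f x - g x\<bar> < 1" using F(3)[OF f] by blast
    have "\<bar>g x\<bar> \<le> B" "\<bar>f x - g x\<bar> < 1" using B(2) g x by auto
    then show "\<bar>f x\<bar> \<le> B + 1" by linarith
  qed (use B in simp)
qed

section \<open>Marginals on a compact product\<close>

context
  fixes D :: "'a::euclidean_space set" and E :: "'b::euclidean_space set"
  assumes D: "compact D" and E: "compact E"
begin

lemma slice_integrable:
  fixes \<rho> :: "'a \<times> 'b \<Rightarrow> real"
  assumes "continuous_on (D \<times> E) \<rho>" "y \<in> E"
  shows "integrable lborel (\<lambda>x. indicator D x * \<rho> (x, y))"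
proof -
  have "continuous_on D (\<lambda>x. \<rho> (x, y))"
    by (rule continuous_on_compose2[OF assms(1)]) (use assms(2) in \<open>auto intro!: continuous_intros\<close>)
  from borel_integrable_compact[OF D this] show ?thesis by simp
qed

lemma integrable_indicator_compact: "integrable lborel (indicator D :: 'a \<Rightarrow> real)"
  using borel_integrable_compact[OF D, of "\<lambda>_. 1::real"] by simp

text \<open>Two densities and two points are allowed at once: equal densities give moduli of
  continuity of the marginal, and comparison with the zero function gives an upper bound for
  it.\<close>

lemma marginal_lipschitz:
  assumes \<rho>: "continuous_on (D \<times> E) \<rho>" "y \<in> E" and \<rho>': "continuous_on (D \<times> E) \<rho>'" "y' \<in> E"
    and e: "\<And>x. x \<in> D \<Longrightarrow> \<bar>\<rho> (x, y) - \<rho>' (x, y')\<bar> \<le> e"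
  shows "\<bar>marginal D \<rho> y - marginal D \<rho>' y'\<bar> \<le> e * measure lborel D"
proof -
  note i = slice_integrable[OF \<rho>] slice_integrable[OF \<rho>']
  have "marginal D \<rho> y - marginal D \<rho>' y' = (LINT x|lborel. indicator D x * \<rho> (x, y) - indicator D x * \<rho>' (x, y'))"
    unfolding marginal_def set_lebesgue_integral_def using i by simp
  also have "\<bar>\<dots>\<bar> \<le> (LINT x|lborel. e * indicator D x)"
    unfolding real_norm_def [symmetric]
  proof (rule Bochner_Integration.integral_norm_bound_integral)
    show "integrable lborel (\<lambda>x. indicator D x * \<rho> (x, y) - indicator D x * \<rho>' (x, y'))" using i by simp
    show "integrable lborel (\<lambda>x. e * indicator D x)" using integrable_indicator_compact by simp
    show "norm (indicator D x * \<rho> (x, y) - indicator D x * \<rho>' (x, y')) \<le> e * indicator D x" for x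
      using e[of x] by (auto simp: indicator_def)
  qed
  also have "\<dots> = e * measure lborel D" by simp
  finally show ?thesis .
qed

lemma product_test_integrable:
  assumes "continuous_on (D \<times> E) \<rho>" and B: "B \<in> sets borel"
  shows "integrable lborel (\<lambda>z. indicator (D \<times> E) z * (\<rho> z * (indicator B (snd z) * c)) :: real)"
proof -
  have "integrable lborel (\<lambda>z. indicator (D \<times> E) z *\<^sub>R \<rho> z)"
    by (intro borel_integrable_compact compact_Times D E assms)
  moreover have "UNIV \<times> B \<in> sets (lborel :: ('a \<times> 'b) measure)"
    using B by (simp add: borel_prod [symmetric] pair_measureI)
  ultimately have "integrable lborel (\<lambda>z. indicator (UNIV \<times> B) z *\<^sub>R (indicator (D \<times> E) z *\<^sub>R \<rho> z))"
    by (rule integrable_mult_indicator[rotated])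
  then have "integrable lborel (\<lambda>z. c * (indicator (UNIV \<times> B) z *\<^sub>R (indicator (D \<times> E) z *\<^sub>R \<rho> z)))"
    by simp
  moreover have "(\<lambda>z. c * (indicator (UNIV \<times> B) z *\<^sub>R (indicator (D \<times> E) z *\<^sub>R \<rho> z)))
     = (\<lambda>z. indicator (D \<times> E) z * (\<rho> z * (indicator B (snd z) * c)))"
    by (auto simp: indicator_def)
  ultimately show ?thesis by (simp only:)
qed

text \<open>By Fubini, testing \<rho> against the normalised indicator of \<open>B\<close> in the
  second variable yields the mean of the marginal over \<open>E \<inter> B\<close>; a mean of values
  within \<open>e\<close> of \<open>a\<close> is itself within \<open>e\<close> of
  \<open>a\<close>.\<close>

lemma marginal_average:
  assumes \<rho>: "continuous_on (D \<times> E) \<rho>" and B: "B \<in> sets borel" and pos: "0 < measure lborel (E \<inter> B)"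
    and e: "\<And>y. y \<in> E \<inter> B \<Longrightarrow> \<bar>marginal D \<rho> y - a\<bar> \<le> e"
  shows "\<bar>(LINT z:D \<times> E|lborel. \<rho> z * (indicator B (snd z) / measure lborel (E \<inter> B))) - a\<bar> \<le> e"
proof -
  define \<mu> where "\<mu> = measure lborel (E \<inter> B)"
  have \<mu>: "\<mu> > 0" using pos \<mu>_def by simp
  define f where "f x y = indicator (D \<times> E) (x, y) * (\<rho> (x, y) * (indicator B y * (1 / \<mu>)))" for x y
  have "integrable lborel (\<lambda>z. indicator (D \<times> E) z * (\<rho> z * (indicator B (snd z) * (1 / \<mu>))))"
    by (rule product_test_integrable[OF \<rho> B])
  also have "(\<lambda>z. indicator (D \<times> E) z * (\<rho> z * (indicator B (snd z) * (1 / \<mu>)))) = (\<lambda>(x, y). f x y)"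
    by (auto simp: f_def)
  finally have int: "integrable (lborel \<Otimes>\<^sub>M lborel) (\<lambda>(x, y). f x y)" by (simp add: lborel_prod)
  have inner: "(LINT x|lborel. f x y) = indicator (E \<inter> B) y * (1 / \<mu>) * marginal D \<rho> y" for y
  proof -
    have "f x y = (indicator (E \<inter> B) y * (1 / \<mu>)) * (indicator D x * \<rho> (x, y))" for x
      by (auto simp: f_def indicator_def)
    then show ?thesis unfolding marginal_def set_lebesgue_integral_def by simp
  qed
  have "(LINT z:D \<times> E|lborel. \<rho> z * (indicator B (snd z) / \<mu>)) = (LINT (x, y)|(lborel \<Otimes>\<^sub>M lborel). f x y)"
    unfolding set_lebesgue_integral_def lborel_prod by (rule Bochner_Integration.integral_cong) (auto simp: f_def)
  also have "\<dots> = (LINT y|lborel. indicator (E \<inter> B) y * (1 / \<mu>) * marginal D \<rho> y)"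
    using lborel_pair.integral_snd[OF int] by (simp add: inner)
  finally have c: "(LINT z:D \<times> E|lborel. \<rho> z * (indicator B (snd z) / \<mu>))
      = (LINT y|lborel. indicator (E \<inter> B) y * (1 / \<mu>) * marginal D \<rho> y)" .
  have i1: "integrable lborel (\<lambda>y. indicator (E \<inter> B) y * (1 / \<mu>) * marginal D \<rho> y)"
    using lborel_pair.integrable_snd[OF int] by (simp add: inner)
  have EB: "E \<inter> B \<in> sets lborel" using E B by (auto simp: compact_imp_closed)
  have "emeasure lborel (E \<inter> B) < \<infinity>"
    using E by (intro emeasure_bounded_finite) (auto intro: bounded_Int compact_imp_bounded)
  then have i2: "integrable lborel (indicator (E \<inter> B) :: 'b \<Rightarrow> real)"
    using EB by (simp add: integrable_indicator_iff)
  \<comment> \<open>The number \<open>a\<close> is written as its own mean over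
    \<open>E \<inter> B\<close>, so that the difference becomes a single integral.\<close>
  have a: "a = (LINT y|lborel. indicator (E \<inter> B) y * (a / \<mu>))"
    using \<mu> by (simp add: \<mu>_def)
  have "(LINT y|lborel. indicator (E \<inter> B) y * (1 / \<mu>) * marginal D \<rho> y) - a
     = (LINT y|lborel. indicator (E \<inter> B) y * (1 / \<mu>) * marginal D \<rho> y - indicator (E \<inter> B) y * (a / \<mu>))"
    using i1 i2 a by (subst Bochner_Integration.integral_diff) auto
  also have "\<bar>\<dots>\<bar> \<le> (LINT y|lborel. indicator (E \<inter> B) y * (e / \<mu>))"
    unfolding real_norm_def [symmetric]
  proof (rule Bochner_Integration.integral_norm_bound_integral)
    show "integrable lborel (\<lambda>y. indicator (E \<inter> B) y * (1 / \<mu>) * marginal D \<rho> y - indicator (E \<inter> B) y * (a / \<mu>))"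
      using i1 i2 by auto
    show "integrable lborel (\<lambda>y. indicator (E \<inter> B) y * (e / \<mu>))" using i2 by simp
    show "norm (indicator (E \<inter> B) y * (1 / \<mu>) * marginal D \<rho> y - indicator (E \<inter> B) y * (a / \<mu>))
        \<le> indicator (E \<inter> B) y * (e / \<mu>)" for y
    proof (cases "y \<in> E \<inter> B")
      case True
      then have "norm (indicator (E \<inter> B) y * (1 / \<mu>) * marginal D \<rho> y - indicator (E \<inter> B) y * (a / \<mu>))
        = \<bar>marginal D \<rho> y - a\<bar> / \<mu>" using \<mu> by (simp add: diff_divide_distrib [symmetric])
      also have "\<dots> \<le> e / \<mu>" using e[OF True] \<mu> by (simp add: divide_right_mono)
      finally show ?thesis using True by simp
    qed simp
  qed
  also have "\<dots> = e" using \<mu> by (simp add: \<mu>_def)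
  finally have "\<bar>(LINT y|lborel. indicator (E \<inter> B) y * (1 / \<mu>) * marginal D \<rho> y) - a\<bar> \<le> e" .
  then have "\<bar>(LINT z:D \<times> E|lborel. \<rho> z * (indicator B (snd z) / \<mu>)) - a\<bar> \<le> e"
    by (simp only: c)
  then show ?thesis by (simp only: \<mu>_def)
qed

lemma marginal_continuous:
  assumes \<rho>: "continuous_on (D \<times> E) \<rho>"
  shows "continuous_on E (marginal D \<rho>)"
  unfolding continuous_on_iff
proof (intro ballI allI impI)
  fix y and e :: real assume y: "y \<in> E" and e: "e > 0"
  have D1: "0 < measure lborel D + 1" by (intro add_nonneg_pos measure_nonneg) auto
  \<comment> \<open>The added 1 keeps the denominator positive if \<open>D\<close> has measure
    zero.\<close>
  define e' where "e' = e / (measure lborel D + 1)"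
  have e': "e' > 0" unfolding e'_def using e D1 by simp
  have "uniformly_continuous_on (D \<times> E) \<rho>"
    by (intro compact_uniformly_continuous \<rho> compact_Times D E)
  then obtain d where d: "d > 0" "\<And>z z'. z \<in> D \<times> E \<Longrightarrow> z' \<in> D \<times> E \<Longrightarrow> dist z' z < d \<Longrightarrow> dist (\<rho> z') (\<rho> z) < e'"
    using e' by (rule uniformly_continuous_onE) (rule that; blast)
  have "dist (marginal D \<rho> y') (marginal D \<rho> y) < e" if y': "y' \<in> E" "dist y' y < d" for y'
  proof -
    have "\<bar>\<rho> (x, y') - \<rho> (x, y)\<bar> \<le> e'" if "x \<in> D" for x
    proof -
      have "dist (\<rho> (x, y')) (\<rho> (x, y)) < e'"
        using that y y' by (intro d(2)) (auto simp: dist_Pair_Pair)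
      then show ?thesis unfolding dist_real_def by simp
    qed
    then have "\<bar>marginal D \<rho> y' - marginal D \<rho> y\<bar> \<le> e' * measure lborel D"
      by (intro marginal_lipschitz[OF \<rho> y'(1) \<rho> y])
    also have "\<dots> < e' * (measure lborel D + 1)" using e' by simp
    also have "\<dots> = e" unfolding e'_def using D1 by simp
    finally show ?thesis by (simp add: dist_real_def)
  qed
  with d(1) show "\<exists>d>0. \<forall>y'\<in>E. dist y' y < d \<longrightarrow> dist (marginal D \<rho> y') (marginal D \<rho> y) < e" by blast
qed

text \<open>The pieces \<open>B j\<close> are balls around a finite net of \<open>E\<close>, and \<open>\<theta>\<close> is the partition of unity
  given by normalised tent functions on them.\<close>

lemma marginal_finite_rank:
  assumes lip: "lipschitz_boundary E"
    and K: "compactin (mtopology_of (cont_space (D \<times> E))) K" and e: "e > 0"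
  shows "\<exists>(M::nat) B \<theta>. (\<forall>j<M. B j \<in> sets borel \<and> continuous_on E (\<theta> j)) \<and>
    (\<forall>\<rho>\<in>K. \<forall>y\<in>E.
       \<bar>(\<Sum>j<M. (LINT z:D \<times> E|lborel. \<rho> z * (indicator (B j) (snd z) / measure lborel (E \<inter> B j))) * \<theta> j y)
          - marginal D \<rho> y\<bar> \<le> e)"
proof -
  have D1: "0 < measure lborel D + 1" by (intro add_nonneg_pos measure_nonneg) auto
  define e' where "e' = e / (measure lborel D + 1)"
  have e': "e' > 0" unfolding e'_def using e D1 by simp
  have e'D: "e' * measure lborel D \<le> e"
  proof -
    have "e' * measure lborel D \<le> e' * (measure lborel D + 1)" using e' by simp
    also have "\<dots> = e" unfolding e'_def using D1 by simp
    finally show ?thesis .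
  qed
  have DE: "compact (D \<times> E)" by (intro compact_Times D E)
  obtain r where r: "r > 0" "\<And>\<rho> z z'. \<rho> \<in> K \<Longrightarrow> z \<in> D \<times> E \<Longrightarrow> z' \<in> D \<times> E \<Longrightarrow> dist z z' < r \<Longrightarrow> \<bar>\<rho> z - \<rho> z'\<bar> < e'"
    using compactin_cont_space_equicontinuous[OF DE K e'] by blast
  have cont: "continuous_on (D \<times> E) \<rho>" if "\<rho> \<in> K" for \<rho>
    using that compactin_cont_space_subset[OF K] mem_cont_space[OF DE] by blast
  \<comment> \<open>Half the radius of equicontinuity: two points in the same ball are less than
    \<open>r\<close> apart. The centres lie in \<open>E\<close>, so each ball meets \<open>E\<close>
    in positive measure.\<close>
  obtain C where C: "finite C" "C \<subseteq> E" "E \<subseteq> (\<Union>c\<in>C. ball c (r / 2))"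
  proof (rule compactE_image[OF E, of E "\<lambda>c. ball c (r / 2)"])
    show "E \<subseteq> (\<Union>c\<in>E. ball c (r / 2))" using r(1) by auto
  qed auto
  obtain h where h: "bij_betw h {..<card C} C"
    using ex_bij_betw_nat_finite[OF C(1)] by (auto simp: atLeast0LessThan)
  define w where "w j y = max 0 (r / 2 - dist y (h j))" for j y
  define s where "s y = (\<Sum>j<card C. w j y)" for y
  have wc: "continuous_on E (w j)" for j unfolding w_def by (intro continuous_intros)
  have w0: "w j y \<ge> 0" for j y unfolding w_def by simp
  have s: "s y > 0" if "y \<in> E" for y
  proof -
    have "y \<in> (\<Union>c\<in>C. ball c (r / 2))" using C(3) that by (rule subsetD)
    then obtain c where c: "c \<in> C" "dist c y < r / 2" by (auto simp only: UN_iff mem_ball)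
    moreover have "c \<in> h ` {..<card C}" using c(1) h by (simp add: bij_betw_def)
    ultimately obtain j where j: "j < card C" "dist (h j) y < r / 2" by (auto simp only: lessThan_iff)
    then have "w j y > 0" unfolding w_def by (simp add: dist_commute)
    also have "w j y \<le> s y" unfolding s_def using j(1) w0 by (intro member_le_sum) auto
    finally show ?thesis .
  qed
  show ?thesis
  proof (intro exI[of _ "card C"] exI[of _ "\<lambda>j. ball (h j) (r / 2)"] exI[of _ "\<lambda>j y. w j y / s y"] conjI allI impI ballI)
    show "continuous_on E (\<lambda>y. w j y / s y)" for j
      using s by (intro continuous_on_divide wc) (auto simp: s_def intro!: continuous_on_sum wc less_imp_neq[THEN not_sym])
    fix \<rho> y assume \<rho>: "\<rho> \<in> K" and y: "y \<in> E"
    define c where "c j = (LINT z:D \<times> E|lborel. \<rho> z * (indicator (ball (h j) (r / 2)) (snd z) / measure lborel (E \<inter> ball (h j) (r / 2))))" for j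
    \<comment> \<open>Only pieces whose tent is positive at \<open>y\<close> enter the sum, and
      their balls contain \<open>y\<close>; no estimate is available or required for the
      others.\<close>
    have c: "\<bar>c j - marginal D \<rho> y\<bar> \<le> e" if j: "j < card C" and wj: "w j y \<noteq> 0" for j
      unfolding c_def
    proof (rule marginal_average[OF cont[OF \<rho>]])
      have hj: "h j \<in> E" using h j C(2) by (auto simp: bij_betw_def)
      then show "0 < measure lborel (E \<inter> ball (h j) (r / 2))"
        using r(1) by (intro lipschitz_boundary_measure_pos[OF E lip]) auto
      fix y' assume y': "y' \<in> E \<inter> ball (h j) (r / 2)"
      have "dist y (h j) < r / 2" using wj unfolding w_def by (auto simp: max_def split: if_splits)
      moreover have "dist (h j) y' < r / 2" using y' by simp
      ultimately have yy: "dist y' y < r" using dist_triangle[of y' y "h j"] by (simp add: dist_commute)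
      have "\<bar>\<rho> (x, y') - \<rho> (x, y)\<bar> \<le> e'" if "x \<in> D" for x
        using r(2)[OF \<rho>, of "(x, y')" "(x, y)"] that y y' yy by (simp add: dist_Pair_Pair less_imp_le)
      then have "\<bar>marginal D \<rho> y' - marginal D \<rho> y\<bar> \<le> e' * measure lborel D"
        using y' y by (intro marginal_lipschitz cont[OF \<rho>]) auto
      with e'D show "\<bar>marginal D \<rho> y' - marginal D \<rho> y\<bar> \<le> e" by linarith
    qed simp
    have sum1: "(\<Sum>j<card C. w j y / s y) = 1"
      using s[OF y] by (simp add: sum_divide_distrib [symmetric] s_def [symmetric])
    \<comment> \<open>The approximant is a convex combination of the \<open>c j\<close>, so the
      marginal may be subtracted inside the sum.\<close>
    have "(\<Sum>j<card C. c j * (w j y / s y)) - marginal D \<rho> y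
       = (\<Sum>j<card C. c j * (w j y / s y)) - marginal D \<rho> y * (\<Sum>j<card C. w j y / s y)"
      using sum1 by simp
    also have "\<dots> = (\<Sum>j<card C. (c j - marginal D \<rho> y) * (w j y / s y))"
      by (simp only: sum_distrib_left left_diff_distrib sum_subtractf)
    also have "\<bar>\<dots>\<bar> \<le> (\<Sum>j<card C. e * (w j y / s y))"
    proof (rule order_trans[OF sum_abs], rule sum_mono)
      fix j assume "j \<in> {..<card C}"
      then have j: "j < card C" by simp
      show "\<bar>(c j - marginal D \<rho> y) * (w j y / s y)\<bar> \<le> e * (w j y / s y)"
      proof (cases "w j y = 0")
        case False
        have "\<bar>(c j - marginal D \<rho> y) * (w j y / s y)\<bar> = \<bar>c j - marginal D \<rho> y\<bar> * (w j y / s y)"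
          using w0[of j y] s[OF y] by (simp add: abs_mult)
        also have "\<dots> \<le> e * (w j y / s y)"
          using c[OF j False] w0[of j y] s[OF y] by (intro mult_right_mono) auto
        finally show ?thesis .
      qed simp
    qed
    also have "\<dots> = e" unfolding sum_distrib_left [symmetric] sum1 by simp
    finally show "\<bar>(\<Sum>j<card C. c j * (w j y / s y)) - marginal D \<rho> y\<bar> \<le> e" .
  qed simp
qed

end

section \<open>Neural operators with one hidden layer\<close>

text \<open>These are the intermediate spaces of the operator: fields that are undefined off
  \<open>S\<close> and continuous in each component.\<close>

definition cont_fields :: "'a::topological_space set \<Rightarrow> nat \<Rightarrow> ('a \<Rightarrow> real Matrix.vec) set" where
  "cont_fields S n = {f \<in> S \<rightarrow>\<^sub>E carrier_vec n. \<forall>i<n. continuous_on S (\<lambda>x. vec_index (f x) i)}"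

lemma coords_append_continuous:
  fixes S :: "'a::euclidean_space set"
  assumes f: "f \<in> cont_fields S n"
  shows "\<And>x. x \<in> S \<Longrightarrow> coords x @\<^sub>v f x \<in> carrier_vec (DIM('a) + n)"
    and "\<And>i. i < DIM('a) + n \<Longrightarrow> continuous_on S (\<lambda>x. vec_index (coords x @\<^sub>v f x) i)"
proof -
  have c: "coords x \<in> carrier_vec DIM('a)" for x :: 'a by (simp add: coords_def)
  have fx: "f x \<in> carrier_vec n" if "x \<in> S" for x using f that unfolding cont_fields_def by auto
  show "coords x @\<^sub>v f x \<in> carrier_vec (DIM('a) + n)" if "x \<in> S" for x
    using c fx[OF that] by (rule append_carrier_vec)
  fix i assume i: "i < DIM('a) + n"
  show "continuous_on S (\<lambda>x. vec_index (coords x @\<^sub>v f x) i)"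
  proof (cases "i < DIM('a)")
    case True
    have "continuous_on S (\<lambda>x. inner x (from_nat_into Basis i))" by (intro continuous_intros)
    moreover have "vec_index (coords x @\<^sub>v f x) i = inner x (from_nat_into Basis i)" if "x \<in> S" for x
      using True fx[OF that] c[of x] i by (simp add: coords_def)
    ultimately show ?thesis by (simp cong: continuous_on_cong)
  next
    case False
    then have "continuous_on S (\<lambda>x. vec_index (f x) (i - DIM('a)))"
      using f i unfolding cont_fields_def by auto
    moreover have "vec_index (coords x @\<^sub>v f x) i = vec_index (f x) (i - DIM('a))" if "x \<in> S" for x
      using False fx[OF that] c[of x] i by (simp add: coords_def)
    ultimately show ?thesis by (simp cong: continuous_on_cong)
  qed
qed

lemma projection_layer_cont_space:
  fixes S :: "'a::euclidean_space set"
  assumes S: "compact S" and Q: "neural_network \<sigma> (DIM('a) + n) 1 Q" and \<sigma>: "continuous_on UNIV \<sigma>"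
    and f: "f \<in> cont_fields S n"
  shows "projection_layer S Q f \<in> mspace (cont_space S)"
proof -
  have "continuous_on S (\<lambda>x. vec_index (Q (coords x @\<^sub>v f x)) 0)"
    using neural_network_continuous[OF Q \<sigma> coords_append_continuous[OF f]] by simp
  then show ?thesis
    unfolding mem_cont_space[OF S] projection_layer_def by (simp cong: continuous_on_cong)
qed

lemma vec_1_eq: "v \<in> carrier_vec 1 \<Longrightarrow> v = Matrix.vec 1 (\<lambda>_. vec_index v 0)"
  by (intro eq_vecI) auto

text \<open>Every ingredient of the layer is chosen to make its component \<open>i\<close> equal to
  \<sigma> applied to \<open>\<alpha> i * f x + \<beta> i * V f x + \<gamma> i\<close>, where
  \<open>V f\<close> is the finite-rank field. Thus the layer evaluates the first layer of a planar
  network at the pair \<open>(f x, V f x)\<close>.\<close>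

lemma neural_operator_one_layer:
  fixes S :: "'a::euclidean_space set" and \<alpha> \<beta> \<gamma> :: "nat \<Rightarrow> real" and M :: nat
  assumes S: "compact S" and \<sigma>: "continuous_on UNIV \<sigma>" and n: "0 < n"
    and Q: "neural_network \<sigma> (DIM('a) + n) 1 Q"
    and \<theta>: "\<And>j. j < M \<Longrightarrow> continuous_on S (\<theta> j)"
    and \<tau>: "\<And>j f. j < M \<Longrightarrow> continuous_on S f \<Longrightarrow> set_integrable lborel S (\<lambda>z. f z * \<tau> j z)"
  shows "\<exists>\<Psi>. neural_operator \<sigma> S (mspace (cont_space S)) (mspace (cont_space S)) \<Psi> \<and>
    (\<forall>f\<in>mspace (cont_space S). \<Psi> f \<in> mspace (cont_space S)) \<and>
    (\<forall>f\<in>mspace (cont_space S). \<forall>x\<in>S.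
       \<Psi> f x = vec_index (Q (coords x @\<^sub>v Matrix.vec n (\<lambda>i. \<sigma> (\<alpha> i * f x
         + \<beta> i * (\<Sum>j<M. (LINT z:S|lborel. f z * \<tau> j z) * \<theta> j x) + \<gamma> i)))) 0)"
proof -
  \<comment> \<open>The lifting drops the coordinates and passes \<open>f x\<close> on
    unchanged.\<close>
  define R where "R v = Matrix.mat 1 (DIM('a) + 1) (\<lambda>(i, j). if j < DIM('a) then 0 else (\<lambda>_ _. 1) i (j - DIM('a))) *\<^sub>v v
      + Matrix.vec 1 (\<lambda>_. 0::real)" for v
  define W where "W = Matrix.mat n 1 (\<lambda>(i, j). (\<lambda>i _. \<alpha> i) i j)"
  define b where "b = Matrix.vec n \<gamma>"
  \<comment> \<open>The pairing is a scalar product in dimension \<open>n\<close>, so the scalar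
    field and \<open>\<tau> j\<close> are both placed in component 0, which exists because
    \<open>n\<close> is positive; the factor \<open>\<beta> i\<close> is left to the decoding
    functions.\<close>
  define T where "T = Matrix.mat n 1 (\<lambda>(i, j). (\<lambda>i _. if i = 0 then 1 else 0 :: real) i j)"
  define \<psi> where "\<psi> j z = Matrix.vec n (\<lambda>i. if i = 0 then \<tau> j z else 0)" for j z
  define \<phi> where "\<phi> j = (\<lambda>z\<in>S. Matrix.vec n (\<lambda>i. \<beta> i * \<theta> j z))" for j
  define H where "H = hidden_layer \<sigma> S n W b M (\<lambda>_. T) \<psi> \<phi>"
  define V where "V f x = (\<Sum>j<M. (LINT z:S|lborel. f z * \<tau> j z) * \<theta> j x)" for f x
  define d where "d l = (if l = 0 then 1 else n)" for l :: nat
  define \<Psi> where "\<Psi> f = projection_layer S Q (H (lifting_layer S R f))" for f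
  let ?X = "mspace (cont_space S)"
  have R_eq: "R (coords x @\<^sub>v Matrix.vec 1 (\<lambda>_. t)) = Matrix.vec 1 (\<lambda>_. t)" for x :: 'a and t
    unfolding R_def by (subst affine_append_eq) (auto simp: coords_def)
  have lift: "lifting_layer S R f = (\<lambda>x\<in>S. Matrix.vec 1 (\<lambda>_. f x))" for f
    unfolding lifting_layer_def R_eq ..
  have lift_mem: "lifting_layer S R f \<in> cont_fields S 1" if "f \<in> ?X" for f
    using that unfolding mem_cont_space[OF S] lift cont_fields_def
    by (auto simp: cong: continuous_on_cong)
  have Tv: "scalar_prod (T *\<^sub>v Matrix.vec 1 (\<lambda>_. t)) (\<psi> j z) = t * \<tau> j z" for t j z
  proof -
    have T1: "T *\<^sub>v Matrix.vec 1 (\<lambda>_. t) = Matrix.vec n (\<lambda>i. if i = 0 then t else 0)"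
      unfolding T_def by (intro eq_vecI) (auto simp: scalar_prod_def)
    have "scalar_prod (T *\<^sub>v Matrix.vec 1 (\<lambda>_. t)) (\<psi> j z) = (\<Sum>i<n. (if i = 0 then t else 0) * (if i = 0 then \<tau> j z else 0))"
      unfolding T1 \<psi>_def by (simp add: scalar_prod_def atLeast0LessThan)
    also have "\<dots> = (\<Sum>i<n. if i = 0 then t * \<tau> j z else 0)" by (intro sum.cong) auto
    also have "\<dots> = t * \<tau> j z" using n by (simp add: sum.delta)
    finally show ?thesis .
  qed
  have Tf: "scalar_prod (T *\<^sub>v f z) (\<psi> j z) = vec_index (f z) 0 * \<tau> j z" if "f \<in> cont_fields S 1" "z \<in> S" for f j z
  proof -
    have "f z \<in> carrier_vec 1" using that unfolding cont_fields_def by auto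
    from vec_1_eq[OF this] Tv[of "vec_index (f z) 0" j z] show ?thesis by metis
  qed
  have pair: "pairing S (\<lambda>z. T *\<^sub>v f z) (\<psi> j) = (LINT z:S|lborel. vec_index (f z) 0 * \<tau> j z)"
    if "f \<in> cont_fields S 1" for f j
    unfolding pairing_def set_lebesgue_integral_def
    by (intro Bochner_Integration.integral_cong) (auto simp: indicator_def Tf[OF that])
  have H_eq: "H f x = Matrix.vec n (\<lambda>i. \<sigma> (\<alpha> i * vec_index (f x) 0 + \<beta> i * V (\<lambda>z. vec_index (f z) 0) x + \<gamma> i))"
    if f: "f \<in> cont_fields S 1" and x: "x \<in> S" for f x
  proof -
    have fx: "f x \<in> carrier_vec 1" using f x unfolding cont_fields_def by auto
    have W: "W *\<^sub>v f x + b = Matrix.vec n (\<lambda>i. \<gamma> i + \<alpha> i * vec_index (f x) 0)"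
      unfolding W_def b_def by (subst vec_1_eq[OF fx], subst affine_vec_eq) simp
    have "H f x = map_vec \<sigma> (W *\<^sub>v f x + b + Matrix.vec n (\<lambda>i. \<Sum>j<M. (LINT z:S|lborel. vec_index (f z) 0 * \<tau> j z) * vec_index (\<phi> j x) i))"
      unfolding H_def hidden_layer_def pair[OF f] using x by simp
    also have "\<dots> = Matrix.vec n (\<lambda>i. \<sigma> (\<alpha> i * vec_index (f x) 0 + \<beta> i * V (\<lambda>z. vec_index (f z) 0) x + \<gamma> i))"
      unfolding W using x by (intro eq_vecI) (auto simp: \<phi>_def V_def sum_distrib_left algebra_simps)
    finally show ?thesis .
  qed
  have V_cont: "continuous_on S (V f)" for f
    unfolding V_def by (intro continuous_intros \<theta>) auto
  have H_mem: "H f \<in> cont_fields S n" if f: "f \<in> cont_fields S 1" for f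
    unfolding cont_fields_def
  proof (intro CollectI conjI allI impI PiE_I)
    show "H f x \<in> carrier_vec n" if "x \<in> S" for x using H_eq[OF f that] by simp
    show "H f x = undefined" if "x \<notin> S" for x using that unfolding H_def hidden_layer_def by simp
    fix i assume i: "i < n"
    have "continuous_on S (\<lambda>x. vec_index (f x) 0)" using f unfolding cont_fields_def by simp
    then have "continuous_on S (\<lambda>x. \<sigma> (\<alpha> i * vec_index (f x) 0 + \<beta> i * V (\<lambda>z. vec_index (f z) 0) x + \<gamma> i))"
      by (intro continuous_on_compose2[OF \<sigma>] continuous_on_add continuous_on_mult continuous_on_const V_cont) auto
    then show "continuous_on S (\<lambda>x. vec_index (H f x) i)"
      using i by (simp add: H_eq[OF f] cong: continuous_on_cong)
  qed
  have \<phi>_mem: "\<phi> j \<in> cont_fields S n" if "j < M" for j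
    using \<theta>[OF that] unfolding \<phi>_def cont_fields_def
    by (auto cong: continuous_on_cong intro!: continuous_intros)
  have proj: "projection_layer S Q f \<in> ?X" if "f \<in> cont_fields S n" for f
    by (rule projection_layer_cont_space[OF S Q \<sigma> that])
  show ?thesis
  proof (intro exI[of _ \<Psi>] conjI ballI)
    show "neural_operator \<sigma> S ?X ?X \<Psi>"
      unfolding neural_operator_def
    proof (rule exI[of _ 1], rule exI[of _ d], rule exI[of _ "\<lambda>l. cont_fields S (d l)"], rule exI[of _ R],
        rule exI[of _ "\<lambda>_. W"], rule exI[of _ "\<lambda>_. b"], rule exI[of _ "\<lambda>_. M"], rule exI[of _ "\<lambda>_ _. T"],
        rule exI[of _ "\<lambda>_. \<psi>"], rule exI[of _ "\<lambda>_. \<phi>"], rule exI[of _ Q], intro conjI)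
      show "\<forall>l\<le>1. 0 < d l \<and> cont_fields S (d l) \<subseteq> S \<rightarrow>\<^sub>E carrier_vec (d l)"
        unfolding d_def cont_fields_def using n by auto
      show "neural_network \<sigma> (DIM('a) + 1) (d 0) R"
        unfolding d_def R_def by (simp, intro neural_network.affine) auto
      show "lifting_layer S R \<in> ?X \<rightarrow> cont_fields S (d 0)"
        using lift_mem by (simp add: d_def del: mspace_cfunspace)
      show "\<forall>l\<in>{1..1}. W \<in> carrier_mat (d l) (d (l - 1)) \<and> b \<in> carrier_vec (d l) \<and>
           (\<forall>j<M. T \<in> carrier_mat (d l) (d (l - 1)) \<and> \<psi> j \<in> S \<rightarrow> carrier_vec (d l) \<and>
              \<phi> j \<in> cont_fields S (d l) \<and>
              (\<forall>f\<in>cont_fields S (d (l - 1)). set_integrable lborel S (\<lambda>z. scalar_prod (T *\<^sub>v f z) (\<psi> j z)))) \<and>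
           hidden_layer \<sigma> S (d l) W b M (\<lambda>_. T) \<psi> \<phi> \<in> cont_fields S (d (l - 1)) \<rightarrow> cont_fields S (d l)"
      proof (intro ballI)
        fix l :: nat assume "l \<in> {1..1}"
        then have l: "d l = n" "d (l - 1) = 1" by (auto simp: d_def)
        have "set_integrable lborel S (\<lambda>z. scalar_prod (T *\<^sub>v f z) (\<psi> j z))" if "j < M" "f \<in> cont_fields S 1" for j f
        proof -
          have "set_integrable lborel S (\<lambda>z. vec_index (f z) 0 * \<tau> j z)"
            using that(2) by (intro \<tau>[OF that(1)]) (auto simp: cont_fields_def)
          also have "?this \<longleftrightarrow> ?thesis"
            unfolding set_integrable_def
            by (intro Bochner_Integration.integrable_cong) (auto simp: indicator_def Tf[OF that(2)])
          finally show ?thesis .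
        qed
        moreover have "hidden_layer \<sigma> S n W b M (\<lambda>_. T) \<psi> \<phi> \<in> cont_fields S 1 \<rightarrow> cont_fields S n"
          using H_mem unfolding H_def by blast
        ultimately show "W \<in> carrier_mat (d l) (d (l - 1)) \<and> b \<in> carrier_vec (d l) \<and>
           (\<forall>j<M. T \<in> carrier_mat (d l) (d (l - 1)) \<and> \<psi> j \<in> S \<rightarrow> carrier_vec (d l) \<and>
              \<phi> j \<in> cont_fields S (d l) \<and>
              (\<forall>f\<in>cont_fields S (d (l - 1)). set_integrable lborel S (\<lambda>z. scalar_prod (T *\<^sub>v f z) (\<psi> j z)))) \<and>
           hidden_layer \<sigma> S (d l) W b M (\<lambda>_. T) \<psi> \<phi> \<in> cont_fields S (d (l - 1)) \<rightarrow> cont_fields S (d l)"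
          unfolding l using \<phi>_mem by (simp add: W_def b_def T_def \<psi>_def)
      qed
      show "neural_network \<sigma> (DIM('a) + d 1) 1 Q" using Q by (simp add: d_def)
      show "projection_layer S Q \<in> cont_fields S (d 1) \<rightarrow> ?X" using proj by (simp add: d_def del: mspace_cfunspace)
      show "\<forall>f\<in>?X. \<Psi> f = projection_layer S Q
          (fold (\<lambda>l. hidden_layer \<sigma> S (d l) W b M (\<lambda>_. T) \<psi> \<phi>) [1..<Suc 1] (lifting_layer S R f))"
        by (simp add: \<Psi>_def H_def d_def)
    qed simp
    show "\<Psi> f \<in> ?X" if "f \<in> ?X" for f
      unfolding \<Psi>_def by (intro proj H_mem lift_mem that)
    fix f x assume f: "f \<in> ?X" and x: "x \<in> S"
    \<comment> \<open>The lifted field agrees with \<open>f\<close> only on \<open>S\<close>, which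
      suffices because the integrals carry the indicator of \<open>S\<close>.\<close>
    have "V (\<lambda>z. vec_index (lifting_layer S R f z) 0) x = V f x"
      unfolding V_def set_lebesgue_integral_def lift
      by (intro sum.cong arg_cong2[where f = "(*)"] Bochner_Integration.integral_cong) (auto simp: indicator_def)
    then have "H (lifting_layer S R f) x = Matrix.vec n (\<lambda>i. \<sigma> (\<alpha> i * f x + \<beta> i * V f x + \<gamma> i))"
      using H_eq[OF lift_mem[OF f] x] x by (simp add: lift)
    then show "\<Psi> f x = vec_index (Q (coords x @\<^sub>v Matrix.vec n (\<lambda>i. \<sigma> (\<alpha> i * f x
         + \<beta> i * (\<Sum>j<M. (LINT z:S|lborel. f z * \<tau> j z) * \<theta> j x) + \<gamma> i)))) 0"
      using x unfolding \<Psi>_def projection_layer_def V_def by simp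
  qed
qed

section \<open>Error estimate for the quotient and conclusion\<close>

text \<open>Since \<eta> is at most \<delta>/2, the perturbed denominator \<open>w\<close> is still
  at least \<delta>/2, and \<open>v * w\<close> is at least half the square of \<delta>.\<close>

lemma quotient_error:
  fixes u v w B \<delta> :: real
  assumes "\<bar>u\<bar> \<le> B" "0 < \<delta>" "\<delta> \<le> v" "\<bar>w - v\<bar> \<le> \<eta>" "\<eta> \<le> \<delta> / 2"
  shows "\<bar>u / v - u / w\<bar> \<le> 2 * B * \<eta> / \<delta>\<^sup>2"
proof -
  have w: "\<delta> / 2 \<le> w" using assms by linarith
  have p: "v > 0" "w > 0" using assms w by linarith+
  have "u / v - u / w = u * (w - v) / (v * w)" using p by (simp add: field_simps)
  then have "\<bar>u / v - u / w\<bar> = \<bar>u\<bar> * \<bar>w - v\<bar> / (v * w)" using p by (simp add: abs_mult)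
  also have "\<dots> \<le> B * \<eta> / (\<delta> * (\<delta> / 2))"
    using assms w p by (intro frac_le mult_mono mult_nonneg_nonneg mult_pos_pos) auto
  also have "\<dots> = 2 * B * \<eta> / \<delta>\<^sup>2" by (simp add: power2_eq_square)
  finally show ?thesis .
qed

text \<open>Total mass one excludes an empty domain, and nonnegativity bounds the marginals below,
  so that the infimum over \<open>E\<close> really is a lower bound for each of them.\<close>

lemma X_spaceD:
  assumes DE: "compact D" "compact E" and \<rho>: "\<rho> \<in> X_space D E \<delta>"
  shows "\<rho> \<in> mspace (cont_space (D \<times> E))" "D \<times> E \<noteq> {}" "\<And>y. y \<in> E \<Longrightarrow> \<delta> \<le> marginal D \<rho> y"
proof -
  have ac: "\<rho> \<in> mspace (cont_space (D \<times> E))" "\<forall>z\<in>D \<times> E. 0 \<le> \<rho> z" "(LINT z:D \<times> E|lborel. \<rho> z) = 1"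
    and inf: "\<delta> \<le> (INF y\<in>E. marginal D \<rho> y)"
    using \<rho> unfolding X_space_def ac_densities_def by auto
  show "\<rho> \<in> mspace (cont_space (D \<times> E))" by (rule ac)
  show "D \<times> E \<noteq> {}"
  proof
    assume e: "D \<times> E = {}"
    show False using ac(3) unfolding set_lebesgue_integral_def e by simp
  qed
  have nn: "0 \<le> marginal D \<rho> y" if "y \<in> E" for y
    unfolding marginal_def set_lebesgue_integral_def
    using ac(2) that by (intro Bochner_Integration.integral_nonneg) (auto simp: indicator_def)
  show "\<delta> \<le> marginal D \<rho> y" if "y \<in> E" for y
  proof -
    have "(INF y\<in>E. marginal D \<rho> y) \<le> marginal D \<rho> y"
      using nn that by (intro cINF_lower bdd_belowI2[of E 0]) auto
    with inf show ?thesis by linarith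
  qed
qed

theorem theorem3p7:
  fixes D :: "(real ^ 'm) set" and E :: "(real ^ 'r) set"
    and \<delta> \<epsilon> :: real
    and K :: "((real ^ 'm) \<times> (real ^ 'r) \<Rightarrow> real) set"
    and \<sigma> :: "real \<Rightarrow> real"
  assumes "compact D" and "lipschitz_boundary D"
    and "compact E" and "lipschitz_boundary E"
    and "continuous_on UNIV \<sigma>" and "\<not> (\<exists>a c. \<forall>t. \<sigma> t = a * t + c)"
    and "0 < \<delta>"
    and "K \<subseteq> X_space D E \<delta>"
    and "compactin (mtopology_of (cont_space (D \<times> E))) K"
    and "0 < \<epsilon>"
  shows "\<exists>\<Psi>. neural_operator \<sigma> (D \<times> E)
                 (mspace (cont_space (D \<times> E))) (mspace (cont_space (D \<times> E))) \<Psi> \<and>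
              (SUP \<rho>\<in>K. ereal (mdist (cont_space (D \<times> E)) (kernel_cond D E \<rho>) (\<Psi> \<rho>))) \<le> ereal \<epsilon>"
proof -
  note D = assms(1) and E = assms(3) and \<sigma> = assms(5) and \<delta> = assms(7) and K = assms(9) and \<epsilon> = assms(10)
  define S where "S = D \<times> E"
  have S: "compact S" unfolding S_def by (intro compact_Times D E)
  note K' = K[folded S_def]
  have KX: "\<rho> \<in> X_space D E \<delta>" if "\<rho> \<in> K" for \<rho> using assms(8) that by blast
  have cont: "continuous_on (D \<times> E) \<rho>" if "\<rho> \<in> K" for \<rho>
    using X_spaceD(1)[OF D E KX[OF that]] mem_cont_space[OF S] unfolding S_def by blast
  obtain B where B: "B > 0" "\<And>f x. f \<in> K \<Longrightarrow> x \<in> S \<Longrightarrow> \<bar>f x\<bar> \<le> B"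
    using compactin_cont_space_bounded[OF S K'] by blast
  have marg_le: "marginal D \<rho> y \<le> B * measure lborel D" if "\<rho> \<in> K" "y \<in> E" for \<rho> y
  proof -
    have "\<bar>marginal D \<rho> y - marginal D (\<lambda>_. 0) y\<bar> \<le> B * measure lborel D"
      using B(2)[OF that(1)] that cont by (intro marginal_lipschitz[OF D E]) (auto simp: S_def)
    moreover have "marginal D (\<lambda>_. 0) y = 0" by (simp add: marginal_def set_lebesgue_integral_def)
    ultimately show ?thesis by linarith
  qed
  \<comment> \<open>All pairs of a density value and an approximate marginal fall into this
    rectangle: the marginals lie between \<delta> and \<open>B * measure lborel D\<close>, and the
    approximation moves them by at most \<delta>/2.\<close>
  define X where "X = {-B..B} \<times> {\<delta> / 2..B * measure lborel D + \<delta> / 2}"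
  have X: "compact X" unfolding X_def by (intro compact_Times compact_Icc)
  have "continuous_on X (\<lambda>p. fst p / snd p)"
    using \<delta> unfolding X_def by (intro continuous_intros) auto
  moreover have "\<epsilon> / 2 > 0" using \<epsilon> by simp
  ultimately have "\<exists>k N. N \<in> nets \<sigma> (Suc k) \<and> (\<forall>p\<in>X. \<bar>fst p / snd p - N p\<bar> < \<epsilon> / 2)"
    by (rule deep_nets_dense[OF \<sigma> assms(6) X])
  then obtain k N where N: "N \<in> nets \<sigma> (Suc k)" "\<forall>p\<in>X. \<bar>fst p / snd p - N p\<bar> < \<epsilon> / 2"
    by (elim exE conjE) (rule that)
  obtain n Q \<alpha> \<beta> \<gamma> where n: "0 < n"
    and Q: "neural_network \<sigma> (DIM((real ^ 'm) \<times> (real ^ 'r)) + n) 1 Q"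
    and Q_eq: "\<forall>u v z. z \<in> carrier_vec DIM((real ^ 'm) \<times> (real ^ 'r)) \<longrightarrow>
       Q (z @\<^sub>v Matrix.vec n (\<lambda>i. \<sigma> (\<alpha> i * u + \<beta> i * v + \<gamma> i))) = Matrix.vec 1 (\<lambda>i. N (u, v))"
    by atomize_elim (rule nets_realised[of 1 "\<lambda>_. N" \<sigma> k "DIM((real ^ 'm) \<times> (real ^ 'r))", OF N(1)])
  \<comment> \<open>The first term keeps the approximate marginals inside \<open>X\<close>; the
    second makes the quotient error at most \<epsilon>/2, the other half being spent on the network
    \<open>N\<close>.\<close>
  define \<eta> where "\<eta> = min (\<delta> / 2) (\<epsilon> * \<delta>\<^sup>2 / (4 * B))"
  have \<eta>: "\<eta> > 0" "\<eta> \<le> \<delta> / 2" unfolding \<eta>_def using \<delta> \<epsilon> B by auto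
  have \<eta>B: "2 * B * \<eta> / \<delta>\<^sup>2 \<le> \<epsilon> / 2"
  proof -
    have "2 * B * \<eta> / \<delta>\<^sup>2 \<le> 2 * B * (\<epsilon> * \<delta>\<^sup>2 / (4 * B)) / \<delta>\<^sup>2"
      using B(1) by (intro divide_right_mono mult_left_mono) (auto simp: \<eta>_def)
    also have "\<dots> = \<epsilon> / 2" using B(1) \<delta> by simp
    finally show ?thesis .
  qed
  obtain M :: nat and A \<theta> where A: "\<forall>j<M. A j \<in> sets borel \<and> continuous_on E (\<theta> j)"
    and approx: "\<forall>\<rho>\<in>K. \<forall>y\<in>E.
       \<bar>(\<Sum>j<M. (LINT z:D \<times> E|lborel. \<rho> z * (indicator (A j) (snd z) / measure lborel (E \<inter> A j))) * \<theta> j y)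
          - marginal D \<rho> y\<bar> \<le> \<eta>"
    using marginal_finite_rank[OF D E assms(4) K \<eta>(1)] by (elim exE conjE) (rule that)
  define \<tau> where "\<tau> j z = indicator (A j) (snd z) / measure lborel (E \<inter> A j)" for j and z :: "(real ^ 'm) \<times> (real ^ 'r)"
  have int: "set_integrable lborel S (\<lambda>z. f z * \<tau> j z)" if "j < M" "continuous_on S f" for j f
    using product_test_integrable[OF D E that(2)[unfolded S_def] conjunct1[OF A[rule_format, OF that(1)]], of "1 / measure lborel (E \<inter> A j)"]
    unfolding set_integrable_def S_def \<tau>_def by simp
  have \<theta>c: "continuous_on S (\<lambda>z. \<theta> j (snd z))" if "j < M" for j
    by (rule continuous_on_compose2[OF conjunct2[OF A[rule_format, OF that]]]) (auto simp: S_def intro!: continuous_intros)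
  obtain \<Psi> where \<Psi>: "neural_operator \<sigma> S (mspace (cont_space S)) (mspace (cont_space S)) \<Psi>"
    "\<forall>f\<in>mspace (cont_space S). \<Psi> f \<in> mspace (cont_space S)"
    "\<forall>f\<in>mspace (cont_space S). \<forall>x\<in>S.
       \<Psi> f x = vec_index (Q (coords x @\<^sub>v Matrix.vec n (\<lambda>i. \<sigma> (\<alpha> i * f x
         + \<beta> i * (\<Sum>j<M. (LINT z:S|lborel. f z * \<tau> j z) * \<theta> j (snd x)) + \<gamma> i)))) 0"
    by atomize_elim (rule neural_operator_one_layer[OF S \<sigma> n Q \<theta>c int])
  have "mdist (cont_space S) (kernel_cond D E \<rho>) (\<Psi> \<rho>) \<le> \<epsilon>" if \<rho>: "\<rho> \<in> K" for \<rho>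
  proof -
    note X\<rho> = X_spaceD[OF D E KX[OF \<rho>], folded S_def]
    have "continuous_on S (\<lambda>z. \<rho> z / marginal D \<rho> (snd z))"
    proof (intro continuous_on_divide ballI)
      show "continuous_on S \<rho>" using cont[OF \<rho>] by (simp add: S_def)
      show "continuous_on S (\<lambda>z. marginal D \<rho> (snd z))"
        by (rule continuous_on_compose2[OF marginal_continuous[OF D E cont[OF \<rho>]]])
          (auto simp: S_def intro!: continuous_intros)
      show "marginal D \<rho> (snd z) \<noteq> 0" if "z \<in> S" for z
        using X\<rho>(3)[of "snd z"] that \<delta> by (auto simp: S_def)
    qed
    \<comment> \<open>Membership in the function space is established for both arguments of
      \<open>mdist\<close> before a pointwise bound is turned into a bound on the distance.\<close>
    moreover have kc: "kernel_cond D E \<rho> = (\<lambda>z\<in>S. \<rho> z / marginal D \<rho> (snd z))"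
      unfolding kernel_cond_def S_def by (intro arg_cong2[where f = restrict]) auto
    ultimately have kcX: "kernel_cond D E \<rho> \<in> mspace (cont_space S)"
      unfolding mem_cont_space[OF S] by (simp cong: continuous_on_cong)
    have "\<bar>kernel_cond D E \<rho> z - \<Psi> \<rho> z\<bar> \<le> \<epsilon>" if z: "z \<in> S" for z
    proof -
      define v where "v = (\<Sum>j<M. (LINT z:S|lborel. \<rho> z * \<tau> j z) * \<theta> j (snd z))"
      have y: "snd z \<in> E" using z by (auto simp: S_def)
      have "coords z \<in> carrier_vec DIM((real ^ 'm) \<times> (real ^ 'r))" by (simp add: coords_def)
      then have \<Psi>z: "\<Psi> \<rho> z = N (\<rho> z, v)"
        using \<Psi>(3)[rule_format, OF X\<rho>(1) z] Q_eq by (simp add: v_def)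
      have v: "\<bar>v - marginal D \<rho> (snd z)\<bar> \<le> \<eta>"
        using approx[rule_format, OF \<rho> y] unfolding v_def \<tau>_def S_def .
      have m: "\<delta> \<le> marginal D \<rho> (snd z)" by (rule X\<rho>(3)[OF y])
      have "(\<rho> z, v) \<in> X"
        using B(2)[OF \<rho> z] v m marg_le[OF \<rho> y] \<eta>(2) unfolding X_def by auto
      from N(2)[rule_format, OF this] have "\<bar>\<rho> z / v - N (\<rho> z, v)\<bar> < \<epsilon> / 2" by simp
      moreover have "\<bar>\<rho> z / marginal D \<rho> (snd z) - \<rho> z / v\<bar> \<le> \<epsilon> / 2"
        using quotient_error[OF B(2)[OF \<rho> z] \<delta> m v \<eta>(2)] \<eta>B by linarith
      ultimately have "\<bar>\<rho> z / marginal D \<rho> (snd z) - N (\<rho> z, v)\<bar> \<le> \<epsilon>" by linarith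
      then show ?thesis using z unfolding kc \<Psi>z by simp
    qed
    then show ?thesis
      using cfunspace_mdist_le[OF kcX \<Psi>(2)[rule_format, OF X\<rho>(1)], of \<epsilon>] X\<rho>(2) by (simp add: dist_real_def)
  qed
  then have "(SUP \<rho>\<in>K. ereal (mdist (cont_space S) (kernel_cond D E \<rho>) (\<Psi> \<rho>))) \<le> ereal \<epsilon>"
    by (intro SUP_least) simp
  with \<Psi>(1) show ?thesis unfolding S_def by blast
qed

end
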